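(* Let $(\Lambda_{\mathfrak g},E_{\mathfrak g})$ be a strongly-affine Jacobi structure on a real vector space $\mathfrak g$ of finite dimension. Let $G^+$ be a connected and simply connected Lie group with Lie algebra $(\mathfrak g^+,[\cdot,\cdot]^+)$, and let $\overline{\mathrm{Coad}}:G^+\times\mathfrak g\to\mathfrak g$ be the affine representation of $G^+$ on $\mathfrak g$ whose associated infinitesimal affine representation of $\mathfrak g^+$ is $a\mapsto-X_a^{(\Lambda_{\mathfrak g},E_{\mathfrak g})}$. Then the leaves of the characteristic foliation associated with the Jacobi structure $(\Lambda_{\mathfrak g},E_{\mathfrak g})$ are just the orbits of $\overline{\mathrm{Coad}}$.
   Context: A Jacobi structure on a manifold $N$ is a pair $(\Lambda,E)$ of a bivector field and a vector field such that the Jacobi bracket $\{f,g\}_{(\Lambda,E)}=\Lambda(df,dg)+fE(g)-gE(f)$ satisfies the Jacobi identity. The hamiltonian vector field of $f$ is $X_f^{(\Lambda,E)}=\#_\Lambda(df)+fE$, where $\#_\Lambda(\alpha)(\beta)=\Lambda(\alpha,\beta)$. The characteristic foliation is the generalized (Sussmann) foliation of $N$ integrating the distribution $x\mapsto\#_\Lambda(T_x^*N)+\langle E_x\rangle$, i.e. the span at $x$ of all hamiltonian vector fields. A Jacobi structure on the vector space $\mathfrak g$ is strongly-affine if the Jacobi bracket of two affine functions on $\mathfrak g$ is affine and, for every affine function $a$ on $\mathfrak g$, the vector field $X_a^{(\Lambda_{\mathfrak g},E_{\mathfrak g})}$ maps affine functions to affine functions. $\mathfrak g^+=\mathrm{Aff}(\mathfrak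 g,\mathbb{R})=\mathfrak g^*\times\mathbb{R}$ is the Lie algebra of affine functions on $\mathfrak g$ with bracket $[a,b]^+=\{a,b\}_{(\Lambda_{\mathfrak g},E_{\mathfrak g})}$. The map $a\mapsto-X_a^{(\Lambda_{\mathfrak g},E_{\mathfrak g})}$ is an antihomomorphism of Lie algebras from $\mathfrak g^+$ to affine vector fields on $\mathfrak g$. An affine representation of $G^+$ on $\mathfrak g$ is a smooth left action by affine transformations; its associated infinitesimal representation sends $a\in\mathfrak g^+$ to the infinitesimal generator $x\mapsto\frac{d}{dt}\big|_{t=0}\exp(ta)\cdot x$. The affine representation $\overline{\mathrm{Coad}}$ exists because $G^+$ is simply connected and affine vector fields are complete. *)

theory Defs
  imports "HOL-Analysis.Analysis" "HOL-Algebra.Group_Action"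
begin

section \<open>Smooth maps on open sets of finite-dimensional normed spaces\<close>

text \<open>
  The class $C^k$ through iterated directional derivatives; in finite dimension this agrees with
  the definition through iterated total derivatives. It is meant for open sets only.
\<close>

primrec Ck_on :: "nat \<Rightarrow> 'a set \<Rightarrow> ('a::real_normed_vector \<Rightarrow> 'b::real_normed_vector) \<Rightarrow> bool" where
  "Ck_on 0 S f \<longleftrightarrow> continuous_on S f"
| "Ck_on (Suc k) S f \<longleftrightarrow>
     (\<forall>x\<in>S. f differentiable (at x)) \<and> (\<forall>v. Ck_on k S (\<lambda>x. frechet_derivative f (at x) v))"

definition smooth_on :: "'a set \<Rightarrow> ('a::real_normed_vector \<Rightarrow> 'b::real_normed_vector) \<Rightarrow> bool" where
  "smooth_on S f \<longleftrightarrow> (\<forall>k. Ck_on k S f)"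


section \<open>Smooth manifolds\<close>

text \<open>
  A chart is a pair of its domain and the coordinate map; only the values of the coordinate map on
  the domain matter. An atlas need not be maximal.
\<close>

type_synonym ('m, 'e) chart = "'m set \<times> ('m \<Rightarrow> 'e)"

definition smooth_atlas ::
    "('m::topological_space, 'e::real_normed_vector) chart set \<Rightarrow> bool" where
  "smooth_atlas A \<longleftrightarrow>
     (\<forall>(U, \<phi>)\<in>A. open U \<and> open (\<phi> ` U) \<and> homeomorphism U (\<phi> ` U) \<phi> (inv_into U \<phi>)) \<and>
     (\<Union>(U, \<phi>)\<in>A. U) = UNIV \<and>
     (\<forall>(U, \<phi>)\<in>A. \<forall>(V, \<psi>)\<in>A. smooth_on (\<phi> ` (U \<inter> V)) (\<psi> \<circ> inv_into U \<phi>))"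

definition smooth_map ::
    "('m::topological_space, 'e::real_normed_vector) chart set \<Rightarrow>
     ('n::topological_space, 'f::real_normed_vector) chart set \<Rightarrow> ('m \<Rightarrow> 'n) \<Rightarrow> bool" where
  "smooth_map A B f \<longleftrightarrow> continuous_on UNIV f \<and>
     (\<forall>(U, \<phi>)\<in>A. \<forall>(V, \<psi>)\<in>B. smooth_on (\<phi> ` (U \<inter> f -` V)) (\<psi> \<circ> f \<circ> inv_into U \<phi>))"

definition std_atlas :: "('a::real_normed_vector, 'a) chart set" where
  "std_atlas = {(UNIV, id)}"

definition prod_atlas :: "('m, 'e) chart set \<Rightarrow> ('n, 'f) chart set \<Rightarrow> ('m \<times> 'n, 'e \<times> 'f) chart set" where
  "prod_atlas A B = {(U \<times> V, map_prod \<phi> \<psi>) | U \<phi> V \<psi>. (U, \<phi>) \<in> A \<and> (V, \<psi>) \<in> B}"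

definition smooth_functions ::
    "('m::topological_space, 'e::real_normed_vector) chart set \<Rightarrow> ('m \<Rightarrow> real) set" where
  "smooth_functions A = {f. smooth_map A std_atlas f}"

text \<open>
  Vector fields are the derivations of the algebra of smooth functions. They are made
  extensional (undefined off the smooth functions) so that a field is one HOL function.
\<close>

definition vector_fields ::
    "('m::topological_space, 'e::real_normed_vector) chart set \<Rightarrow> (('m \<Rightarrow> real) \<Rightarrow> 'm \<Rightarrow> real) set" where
  "vector_fields A = {X \<in> smooth_functions A \<rightarrow>\<^sub>E smooth_functions A.
     (\<forall>f\<in>smooth_functions A. \<forall>h\<in>smooth_functions A. \<forall>s t.
        X (\<lambda>p. s * f p + t * h p) = (\<lambda>p. s * X f p + t * X h p)) \<and>
     (\<forall>f\<in>smooth_functions A. \<forall>h\<in>smooth_functions A.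
        X (\<lambda>p. f p * h p) = (\<lambda>p. f p * X h p + h p * X f p))}"

definition vf_bracket ::
    "('m::topological_space, 'e::real_normed_vector) chart set \<Rightarrow> (('m \<Rightarrow> real) \<Rightarrow> 'm \<Rightarrow> real) \<Rightarrow>
     (('m \<Rightarrow> real) \<Rightarrow> 'm \<Rightarrow> real) \<Rightarrow> ('m \<Rightarrow> real) \<Rightarrow> 'm \<Rightarrow> real" where
  "vf_bracket A X Y = (\<lambda>f\<in>smooth_functions A. \<lambda>p. X (Y f) p - Y (X f) p)"

definition vf_lincomb ::
    "('m::topological_space, 'e::real_normed_vector) chart set \<Rightarrow> real \<Rightarrow> (('m \<Rightarrow> real) \<Rightarrow> 'm \<Rightarrow> real) \<Rightarrow>
     real \<Rightarrow> (('m \<Rightarrow> real) \<Rightarrow> 'm \<Rightarrow> real) \<Rightarrow> ('m \<Rightarrow> real) \<Rightarrow> 'm \<Rightarrow> real" where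
  "vf_lincomb A s X t Y = (\<lambda>f\<in>smooth_functions A. \<lambda>p. s * X f p + t * Y f p)"


section \<open>Lie groups\<close>

text \<open>
  The underlying manifold is the whole type, Hausdorff and second countable by its type classes,
  with a model space of positive dimension.
\<close>

definition lie_group ::
    "'g::{t2_space,second_countable_topology} monoid \<Rightarrow> ('g, 'e::euclidean_space) chart set \<Rightarrow> bool" where
  "lie_group G A \<longleftrightarrow> group G \<and> carrier G = UNIV \<and> smooth_atlas A \<and>
     smooth_map (prod_atlas A A) A (\<lambda>(g, h). g \<otimes>\<^bsub>G\<^esub> h) \<and>
     smooth_map A A (\<lambda>g. inv\<^bsub>G\<^esub> g)"

text \<open>The Lie algebra consists of the left-invariant vector fields, with \<^const>\<open>vf_bracket\<close>.\<close>

definition lie_algebra ::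
    "'g::{t2_space,second_countable_topology} monoid \<Rightarrow> ('g, 'e::euclidean_space) chart set \<Rightarrow>
     (('g \<Rightarrow> real) \<Rightarrow> 'g \<Rightarrow> real) set" where
  "lie_algebra G A = {X \<in> vector_fields A.
     \<forall>f\<in>smooth_functions A. \<forall>g. X (\<lambda>p. f (g \<otimes>\<^bsub>G\<^esub> p)) = (\<lambda>p. X f (g \<otimes>\<^bsub>G\<^esub> p))}"

text \<open>
  \<open>\<gamma>\<close> is the curve $t \mapsto \exp(tX)$: the one-parameter subgroup whose velocity at the unit is
  the value of \<open>X\<close> there. Such a curve exists and is unique for every \<open>X\<close> in the Lie algebra.
\<close>

definition exp_curve ::
    "'g::{t2_space,second_countable_topology} monoid \<Rightarrow> ('g, 'e::euclidean_space) chart set \<Rightarrow>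
     (('g \<Rightarrow> real) \<Rightarrow> 'g \<Rightarrow> real) \<Rightarrow> (real \<Rightarrow> 'g) \<Rightarrow> bool" where
  "exp_curve G A X \<gamma> \<longleftrightarrow> smooth_map std_atlas A \<gamma> \<and>
     (\<forall>s t. \<gamma> (s + t) = \<gamma> s \<otimes>\<^bsub>G\<^esub> \<gamma> t) \<and>
     (\<forall>f\<in>smooth_functions A. ((\<lambda>t. f (\<gamma> t)) has_real_derivative X f \<one>\<^bsub>G\<^esub>) (at 0))"

definition affine_map :: "('a::real_vector \<Rightarrow> 'b::real_vector) \<Rightarrow> bool" where
  "affine_map f \<longleftrightarrow> (\<exists>L c. linear L \<and> f = (\<lambda>x. L x + c))"

definition affine_representation ::
    "'g::{t2_space,second_countable_topology} monoid \<Rightarrow> ('g, 'e::euclidean_space) chart set \<Rightarrow>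
     ('g \<Rightarrow> 'v::real_normed_vector \<Rightarrow> 'v) \<Rightarrow> bool" where
  "affine_representation G A act \<longleftrightarrow> group_action G UNIV act \<and>
     smooth_map (prod_atlas A std_atlas) std_atlas (\<lambda>(g, x). act g x) \<and>
     (\<forall>g. affine_map (act g))"

text \<open>\<open>\<xi>\<close> is the vector field $x \mapsto \frac{d}{dt}|_{t=0} \exp(tX)\cdot x$.\<close>

definition infinitesimal_generator ::
    "'g::{t2_space,second_countable_topology} monoid \<Rightarrow> ('g, 'e::euclidean_space) chart set \<Rightarrow>
     ('g \<Rightarrow> 'v::real_normed_vector \<Rightarrow> 'v) \<Rightarrow> (('g \<Rightarrow> real) \<Rightarrow> 'g \<Rightarrow> real) \<Rightarrow> ('v \<Rightarrow> 'v) \<Rightarrow> bool" where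
  "infinitesimal_generator G A act X \<xi> \<longleftrightarrow>
     (\<exists>\<gamma>. exp_curve G A X \<gamma> \<and>
       (\<forall>x. ((\<lambda>t. act (\<gamma> t) x) has_vector_derivative \<xi> x) (at 0)))"


section \<open>Jacobi structures on a vector space\<close>

text \<open>
  Covectors are the bounded linear functionals, which in finite dimension are all linear
  functionals. A bivector at a point is a skew bilinear form on covectors.
\<close>

type_synonym 'v covector = "'v \<Rightarrow>\<^sub>L real"

type_synonym 'v bivector_field = "'v \<Rightarrow> 'v covector \<Rightarrow> 'v covector \<Rightarrow> real"

definition bivector_field :: "'v::real_normed_vector bivector_field \<Rightarrow> bool" where
  "bivector_field \<Lambda> \<longleftrightarrow>
     (\<forall>x. bilinear (\<Lambda> x) \<and> (\<forall>\<alpha> \<beta>. \<Lambda> x \<alpha> \<beta> = - \<Lambda> x \<beta> \<alpha>)) \<and>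
     (\<forall>\<alpha> \<beta>. smooth_on UNIV (\<lambda>x. \<Lambda> x \<alpha> \<beta>))"

definition diff :: "('v::real_normed_vector \<Rightarrow> real) \<Rightarrow> 'v \<Rightarrow> 'v covector" where
  "diff f x = Blinfun (frechet_derivative f (at x))"

definition jacobi_bracket ::
    "'v::real_normed_vector bivector_field \<Rightarrow> ('v \<Rightarrow> 'v) \<Rightarrow> ('v \<Rightarrow> real) \<Rightarrow> ('v \<Rightarrow> real) \<Rightarrow> 'v \<Rightarrow> real" where
  "jacobi_bracket \<Lambda> E f g x =
     \<Lambda> x (diff f x) (diff g x) + f x * blinfun_apply (diff g x) (E x)
                             - g x * blinfun_apply (diff f x) (E x)"

definition jacobi_structure ::
    "'v::real_normed_vector bivector_field \<Rightarrow> ('v \<Rightarrow> 'v) \<Rightarrow> bool" where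
  "jacobi_structure \<Lambda> E \<longleftrightarrow> bivector_field \<Lambda> \<and> smooth_on UNIV E \<and>
     (\<forall>f g h. smooth_on UNIV f \<and> smooth_on UNIV g \<and> smooth_on UNIV h \<longrightarrow>
        (\<forall>x. jacobi_bracket \<Lambda> E f (jacobi_bracket \<Lambda> E g h) x
           + jacobi_bracket \<Lambda> E g (jacobi_bracket \<Lambda> E h f) x
           + jacobi_bracket \<Lambda> E h (jacobi_bracket \<Lambda> E f g) x = 0))"

definition sharp :: "'v::real_normed_vector bivector_field \<Rightarrow> 'v \<Rightarrow> 'v covector \<Rightarrow> 'v" where
  "sharp \<Lambda> x \<alpha> = (THE v. \<forall>\<beta>. blinfun_apply \<beta> v = \<Lambda> x \<alpha> \<beta>)"

definition hamiltonian ::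
    "'v::real_normed_vector bivector_field \<Rightarrow> ('v \<Rightarrow> 'v) \<Rightarrow> ('v \<Rightarrow> real) \<Rightarrow> 'v \<Rightarrow> 'v" where
  "hamiltonian \<Lambda> E f x = sharp \<Lambda> x (diff f x) + f x *\<^sub>R E x"

definition strongly_affine ::
    "'v::real_normed_vector bivector_field \<Rightarrow> ('v \<Rightarrow> 'v) \<Rightarrow> bool" where
  "strongly_affine \<Lambda> E \<longleftrightarrow>
     (\<forall>a b :: 'v \<Rightarrow> real. affine_map a \<and> affine_map b \<longrightarrow>
        affine_map (jacobi_bracket \<Lambda> E a b) \<and>
        affine_map (\<lambda>x. blinfun_apply (diff b x) (hamiltonian \<Lambda> E a x)))"

text \<open>
  \<open>\<iota>\<close> identifies the Lie algebra of affine functions, under the Jacobi bracket, with the Lie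
  algebra of \<open>G\<close>.
\<close>

definition lie_algebra_iso ::
    "'v::real_normed_vector bivector_field \<Rightarrow> ('v \<Rightarrow> 'v) \<Rightarrow>
     'g::{t2_space,second_countable_topology} monoid \<Rightarrow> ('g, 'e::euclidean_space) chart set \<Rightarrow>
     (('v \<Rightarrow> real) \<Rightarrow> ('g \<Rightarrow> real) \<Rightarrow> 'g \<Rightarrow> real) \<Rightarrow> bool" where
  "lie_algebra_iso \<Lambda> E G A \<iota> \<longleftrightarrow>
     bij_betw \<iota> {a. affine_map a} (lie_algebra G A) \<and>
     (\<forall>a b. affine_map a \<and> affine_map b \<longrightarrow>
        (\<forall>s t. \<iota> (\<lambda>x. s * a x + t * b x) = vf_lincomb A s (\<iota> a) t (\<iota> b)) \<and>
        \<iota> (jacobi_bracket \<Lambda> E a b) = vf_bracket A (\<iota> a) (\<iota> b))"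


section \<open>The characteristic foliation\<close>

definition characteristic_distribution ::
    "'v::real_normed_vector bivector_field \<Rightarrow> ('v \<Rightarrow> 'v) \<Rightarrow> 'v \<Rightarrow> 'v set" where
  "characteristic_distribution \<Lambda> E x = {sharp \<Lambda> x \<alpha> + s *\<^sub>R E x | \<alpha> s. True}"

text \<open>
  An immersed submanifold of the vector space is given by a topology \<open>\<tau>\<close> on its set of points
  (in general finer than the subspace topology) and, around each point, a smooth parametrization
  that is an immersion and a homeomorphism onto a \<open>\<tau>\<close>-open set; transition maps are then
  automatically smooth. To let the dimension vary, parameters range over relatively open subsets
  \<open>U \<inter> S\<close> of linear subspaces \<open>S\<close>. It is an integral manifold of \<open>D\<close> if its tangent space,
  the image of \<open>S\<close> under the derivative of the parametrization, is \<open>D\<close> at each point.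
\<close>

definition integral_manifold ::
    "('v::real_normed_vector \<Rightarrow> 'v set) \<Rightarrow> 'v topology \<Rightarrow> bool" where
  "integral_manifold D \<tau> \<longleftrightarrow>
     (\<forall>x\<in>topspace \<tau>. \<exists>S U (\<phi> :: 'v \<Rightarrow> 'v).
        subspace S \<and> open U \<and> smooth_on U \<phi> \<and>
        x \<in> \<phi> ` (U \<inter> S) \<and> openin \<tau> (\<phi> ` (U \<inter> S)) \<and>
        homeomorphic_map (top_of_set (U \<inter> S)) (subtopology \<tau> (\<phi> ` (U \<inter> S))) \<phi> \<and>
        (\<forall>u\<in>U \<inter> S. inj_on (frechet_derivative \<phi> (at u)) S \<and>
                   frechet_derivative \<phi> (at u) ` S = D (\<phi> u)))"

text \<open>
  The leaves of the generalized foliation integrating \<open>D\<close> are its maximal connected integral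
  manifolds: every connected integral manifold meeting a leaf is an open submanifold of it.
\<close>

definition leaf :: "('v::real_normed_vector \<Rightarrow> 'v set) \<Rightarrow> 'v set \<Rightarrow> bool" where
  "leaf D L \<longleftrightarrow> L \<noteq> {} \<and>
     (\<exists>\<tau>. topspace \<tau> = L \<and> connected_space \<tau> \<and> integral_manifold D \<tau> \<and>
       (\<forall>\<tau>'. connected_space \<tau>' \<and> integral_manifold D \<tau>' \<and> topspace \<tau>' \<inter> L \<noteq> {} \<longrightarrow>
          openin \<tau> (topspace \<tau>') \<and> \<tau>' = subtopology \<tau> (topspace \<tau>')))"

end

theory Submission
  imports Defs
begin

text \<open>
  Every tangent vector at the unit of \<open>G\<close> extends to a left-invariant field, hence is the velocity of
  some $\exp(t a)$ with \<open>a\<close> affine (bump functions separate tangent vectors). So the orbit map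
  of \<open>x\<close> has at the unit the derivative with range $\{-X_a(x)\}$, the characteristic distribution
  \<open>D x\<close>, and translating, the rank of \<open>D\<close> is constant along orbits.

  Let $\pi$ be a projection onto \<open>D p\<close> and lift \<open>D p\<close> into the tangent space of \<open>G\<close>.
  The map $z \mapsto g(z) \cdot (p + z - \pi z)$, where $g(z)$ has as chart coordinates those of the
  unit plus the lift of \<open>z\<close>, is a local diffeomorphism at 0 whose slices parallel to \<open>D p\<close> lie in
  orbits. At points of the same rank as \<open>p\<close>, \<open>D\<close> is therefore tangent to the slices, and every map
  tangent to \<open>D\<close> that stays in that rank stays in one slice. This shows both that the slices are open
  in the orbit with the quotient topology from \<open>G\<close>, which makes the orbit an integral manifold, and
  that every integral manifold is locally, by invariance of domain, an open piece of a slice.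
\<close>

section \<open>Calculus of smooth maps\<close>

text \<open>Affine functions span the distribution at a point because their value and their
  differential there can be prescribed independently. Inside a flow box the rank may exceed that at
  the centre, since the tangent spaces of the slices are only contained in the distribution; hence
  the restriction to points of equal rank. It holds along an orbit because \<open>act g\<close>
  carries the distribution to itself, and on an integral manifold because the parameter space has a
  fixed dimension. The obstacle is that \<open>'v\<close> is merely a normed space with a finite
  spanning set, while the theorems of finite-dimensional analysis live on Euclidean types. The
  Euclidean type at hand is the model space \<open>'e\<close> of the group, and it is large enough:
  a basis identifies \<open>'v\<close> with its dual, linear functions belong to the Lie algebra,
  and evaluation at the unit embeds the Lie algebra into the tangent space there, which is
  \<open>'e\<close>. This gives a linear injection \<open>j\<close> with left inverse
  \<open>r\<close>, through which the Euclidean theorems are transported.\<close>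

lemma Ck_on_SucD: "Ck_on (Suc k) S f \<Longrightarrow> Ck_on k S f"
proof (induction k arbitrary: f)
  case 0
  then show ?case
    by (auto simp: intro!: continuous_at_imp_continuous_on differentiable_imp_continuous_within)
next
  case (Suc k)
  have "\<forall>x\<in>S. f differentiable (at x)" "\<And>v. Ck_on (Suc k) S (\<lambda>x. frechet_derivative f (at x) v)"
    using Suc.prems by auto
  then show ?case
    using Suc.IH by (subst Ck_on.simps) blast
qed

lemma Ck_on_subset: "Ck_on k S f \<Longrightarrow> T \<subseteq> S \<Longrightarrow> Ck_on k T f"
  by (induction k arbitrary: f) (auto intro: continuous_on_subset)

text \<open>Derivatives are taken in the full space; openness of \<open>S\<close> is what makes them
  depend only on the values on \<open>S\<close>.\<close>

lemma Ck_on_cong_imp: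
  assumes "open S" "\<And>x. x \<in> S \<Longrightarrow> f x = g x" "Ck_on k S f"
  shows "Ck_on k S g"
  using assms(2,3)
proof (induction k arbitrary: f g)
  case 0
  then show ?case
    by (auto cong: continuous_on_cong_simp)
next
  case (Suc k)
  have 1: "f differentiable (at x)" if "x \<in> S" for x
    using Suc.prems(2) that by auto
  have 2: "g differentiable (at x)" if "x \<in> S" for x
    using has_derivative_transform_within_open[OF 1[OF that, unfolded frechet_derivative_works] assms(1) that]
      Suc.prems(1) differentiable_def by blast
  have 3: "frechet_derivative f (at x) = frechet_derivative g (at x)" if "x \<in> S" for x
    using frechet_derivative_transform_within_open[OF 1[OF that] assms(1) that] Suc.prems(1) by blast
  show ?case
    using 2 Suc.IH[of "\<lambda>x. frechet_derivative f (at x) v" "\<lambda>x. frechet_derivative g (at x) v" for v] 3 Suc.prems(2)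
    by auto
qed

lemma Ck_on_cong:
  assumes "open S" "\<And>x. x \<in> S \<Longrightarrow> f x = g x"
  shows "Ck_on k S f \<longleftrightarrow> Ck_on k S g"
  using Ck_on_cong_imp[of S f g k] Ck_on_cong_imp[of S g f k] assms by auto

lemma Ck_on_local:
  assumes "\<And>x. x \<in> S \<Longrightarrow> \<exists>T. open T \<and> x \<in> T \<and> Ck_on k T f"
  shows "Ck_on k S f"
  using assms
proof (induction k arbitrary: f)
  case 0
  then show ?case
    by (metis Ck_on.simps(1) continuous_at_imp_continuous_on continuous_on_eq_continuous_at)
next
  case (Suc k)
  then show ?case
    by (metis Ck_on.simps(2))
qed

lemma Ck_on_const [simp]: "Ck_on k S (\<lambda>x. c)"
  by (induction k arbitrary: c) auto

lemma Ck_on_bounded_linear: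
  assumes "bounded_linear f"
  shows "Ck_on k S f"
proof (cases k)
  case 0
  then show ?thesis using assms by (simp add: linear_continuous_on)
next
  case (Suc l)
  have *: "(f has_derivative f) (at x)" for x
    using bounded_linear_imp_has_derivative[OF assms] .
  show ?thesis
    using * frechet_derivative_at[OF *] by (auto simp: Suc differentiable_def simp flip: frechet_derivative_at[OF *])
qed

lemma Ck_on_linear_comp:
  assumes "open S" "bounded_linear L" "Ck_on k S f"
  shows "Ck_on k S (\<lambda>x. L (f x))"
  using assms(3)
proof (induction k arbitrary: f)
  case 0
  then show ?case using assms(2)
    by (auto intro: bounded_linear.continuous_on)
next
  case (Suc k)
  have d: "((\<lambda>x. L (f x)) has_derivative (\<lambda>v. L (frechet_derivative f (at x) v))) (at x)" if "x \<in> S" for x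
    using Suc.prems that
    by (intro bounded_linear.has_derivative[OF assms(2)]) (simp add: frechet_derivative_works)
  have "Ck_on k S (\<lambda>x. frechet_derivative (\<lambda>x. L (f x)) (at x) v)" for v
    using Suc.IH[of "\<lambda>x. frechet_derivative f (at x) v"] Suc.prems
    by (subst Ck_on_cong[OF assms(1), where g = "\<lambda>x. L (frechet_derivative f (at x) v)"])
       (auto simp flip: frechet_derivative_at[OF d])
  then show ?case
    using differentiableI[OF d] by auto
qed

text \<open>In the chain rule the inner direction \<open>L v\<close> is the same at every point, so
  the induction stays within fixed directions and the spaces may be arbitrary normed spaces,
  \<open>'v\<close> included.\<close>

lemma Ck_on_affine_precomp:
  assumes "open S" "bounded_linear L" "Ck_on k S f"
  shows "Ck_on k {x. L x + c \<in> S} (\<lambda>x. f (L x + c))"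
  using assms(3)
proof (induction k arbitrary: f)
  case 0
  have "continuous_on {x. L x + c \<in> S} (\<lambda>x. L x + c)"
    by (intro continuous_intros linear_continuous_on assms)
  then show ?case using 0
    by (auto intro!: continuous_on_compose2[of S f])
next
  case (Suc k)
  have op: "open {x. L x + c \<in> S}"
    using open_vimage[OF assms(1), of "\<lambda>x. L x + c"]
    by (simp add: vimage_def continuous_on_add linear_continuous_on assms)
  have l: "((\<lambda>x. L x + c) has_derivative L) (at x)" for x
    using has_derivative_add[OF bounded_linear_imp_has_derivative[OF assms(2)] has_derivative_const]
    by simp
  have d: "((\<lambda>x. f (L x + c)) has_derivative (\<lambda>v. frechet_derivative f (at (L x + c)) (L v))) (at x)"
    if "L x + c \<in> S" for x
    using Suc.prems that
    by (intro has_derivative_compose[OF l]) (simp add: frechet_derivative_works)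
  have "Ck_on k {x. L x + c \<in> S} (\<lambda>x. frechet_derivative (\<lambda>x. f (L x + c)) (at x) v)" for v
    using Suc.IH[of "\<lambda>x. frechet_derivative f (at x) (L v)"] Suc.prems
    by (subst Ck_on_cong[OF op, where g = "\<lambda>x. frechet_derivative f (at (L x + c)) (L v)"])
       (auto simp flip: frechet_derivative_at[OF d])
  then show ?case
    using differentiableI[OF d] by auto
qed

lemma Ck_on_add:
  assumes "open S" "Ck_on k S f" "Ck_on k S g"
  shows "Ck_on k S (\<lambda>x. f x + g x)"
  using assms(2,3)
proof (induction k arbitrary: f g)
  case 0
  then show ?case by (auto intro: continuous_on_add)
next
  case (Suc k)
  have d: "((\<lambda>x. f x + g x) has_derivative
      (\<lambda>v. frechet_derivative f (at x) v + frechet_derivative g (at x) v)) (at x)" if "x \<in> S" for x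
    using Suc.prems that by (intro has_derivative_add) (simp_all add: frechet_derivative_works)
  have "Ck_on k S (\<lambda>x. frechet_derivative (\<lambda>x. f x + g x) (at x) v)" for v
    using Suc.IH[of "\<lambda>x. frechet_derivative f (at x) v" "\<lambda>x. frechet_derivative g (at x) v"] Suc.prems
    by (subst Ck_on_cong[OF assms(1), where g = "\<lambda>x. frechet_derivative f (at x) v + frechet_derivative g (at x) v"])
       (auto simp flip: frechet_derivative_at[OF d])
  then show ?case
    using differentiableI[OF d] by auto
qed

lemma Ck_on_sum:
  assumes "open S" "finite I" "\<And>i. i \<in> I \<Longrightarrow> Ck_on k S (f i)"
  shows "Ck_on k S (\<lambda>x. \<Sum>i\<in>I. f i x)"
  using assms(2,3) by (induction I rule: finite_induct) (auto intro: Ck_on_add[OF assms(1)])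

lemma Ck_on_bilinear:
  assumes "bounded_bilinear B" "open S" "Ck_on k S f" "Ck_on k S g"
  shows "Ck_on k S (\<lambda>x. B (f x) (g x))"
  using assms(3,4)
proof (induction k arbitrary: f g)
  case 0
  then show ?case by (auto intro: bounded_bilinear.continuous_on[OF assms(1)])
next
  case (Suc k)
  have d: "((\<lambda>x. B (f x) (g x)) has_derivative
      (\<lambda>v. B (f x) (frechet_derivative g (at x) v) + B (frechet_derivative f (at x) v) (g x))) (at x)"
    if "x \<in> S" for x
    using Suc.prems that
    by (intro bounded_bilinear.FDERIV[OF assms(1)]) (simp_all add: frechet_derivative_works)
  have "Ck_on k S (\<lambda>x. B (f x) (frechet_derivative g (at x) v) + B (frechet_derivative f (at x) v) (g x))" for v
    using Suc.prems
    by (intro Ck_on_add[OF assms(2)] Suc.IH) (auto intro: Ck_on_SucD simp del: Ck_on.simps(2)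
        simp: Ck_on.simps(2)[of k S f] Ck_on.simps(2)[of k S g])
  then have "Ck_on k S (\<lambda>x. frechet_derivative (\<lambda>x. B (f x) (g x)) (at x) v)" for v
    by (subst Ck_on_cong[OF assms(2), where
        g = "\<lambda>x. B (f x) (frechet_derivative g (at x) v) + B (frechet_derivative f (at x) v) (g x)"])
       (auto simp flip: frechet_derivative_at[OF d])
  then show ?case
    using differentiableI[OF d] by auto
qed

text \<open>\<open>Ck_on\<close> speaks of derivatives in fixed directions, whereas the chain rule
  differentiates \<open>f\<close> in a direction that varies with \<open>x\<close>. Expanding that
  direction in the Euclidean basis of the middle space gives a finite sum of products of maps
  covered by the induction.\<close>

lemma Ck_on_compose:
  fixes f :: "'b::euclidean_space \<Rightarrow> 'c::real_normed_vector" and g :: "'a::real_normed_vector \<Rightarrow> 'b"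
  assumes "open S" "Ck_on k T f" "Ck_on k S g" "g ` S \<subseteq> T"
  shows "Ck_on k S (\<lambda>x. f (g x))"
  using assms(2,3)
proof (induction k arbitrary: f)
  case 0
  then show ?case using assms(4)
    by (auto intro!: continuous_on_compose2[of T f])
next
  case (Suc k)
  have df: "(f has_derivative frechet_derivative f (at (g x))) (at (g x))" if "x \<in> S" for x
    using Suc.prems that assms(4) by (auto simp: frechet_derivative_works)
  have dg: "(g has_derivative frechet_derivative g (at x)) (at x)" if "x \<in> S" for x
    using Suc.prems that by (auto simp: frechet_derivative_works)
  have d: "((\<lambda>x. f (g x)) has_derivative
      (\<lambda>v. frechet_derivative f (at (g x)) (frechet_derivative g (at x) v))) (at x)"
    if "x \<in> S" for x
    using has_derivative_compose[OF dg[OF that] df[OF that]] .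
  have expand: "frechet_derivative f (at (g x)) w =
      (\<Sum>b\<in>Basis. (w \<bullet> b) *\<^sub>R frechet_derivative f (at (g x)) b)" if "x \<in> S" for x w
  proof -
    interpret l: linear "frechet_derivative f (at (g x))"
      using df[OF that] has_derivative_linear by blast
    have "frechet_derivative f (at (g x)) w = frechet_derivative f (at (g x)) (\<Sum>b\<in>Basis. (w \<bullet> b) *\<^sub>R b)"
      by (simp add: euclidean_representation)
    then show ?thesis by (simp add: l.sum l.scale)
  qed
  have gk: "Ck_on k S g" "\<And>v. Ck_on k S (\<lambda>x. frechet_derivative g (at x) v)"
    using Suc.prems(2) Ck_on_SucD by auto
  have "Ck_on k S (\<lambda>x. \<Sum>b\<in>Basis. (frechet_derivative g (at x) v \<bullet> b) *\<^sub>R frechet_derivative f (at (g x)) b)" for v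
    using Suc.prems(1) gk
    by (intro Ck_on_sum Ck_on_bilinear[OF bounded_bilinear_scaleR] assms(1) finite_Basis
        Ck_on_linear_comp[OF _ bounded_linear_inner_left] Suc.IH[of "\<lambda>x. frechet_derivative f (at x) b" for b]) auto
  then have "Ck_on k S (\<lambda>x. frechet_derivative (\<lambda>x. f (g x)) (at x) v)" for v
    by (subst Ck_on_cong[OF assms(1), where
        g = "\<lambda>x. \<Sum>b\<in>Basis. (frechet_derivative g (at x) v \<bullet> b) *\<^sub>R frechet_derivative f (at (g x)) b"])
       (auto simp: expand simp flip: frechet_derivative_at[OF d])
  then show ?case
    using differentiableI[OF d] by auto
qed

section \<open>Rules for smooth maps, read off at every order of differentiability\<close>

lemma smooth_on_subset: "smooth_on S f \<Longrightarrow> T \<subseteq> S \<Longrightarrow> smooth_on T f"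
  unfolding smooth_on_def using Ck_on_subset by blast

lemma smooth_on_cong:
  assumes "open S" "\<And>x. x \<in> S \<Longrightarrow> f x = g x"
  shows "smooth_on S f \<longleftrightarrow> smooth_on S g"
  unfolding smooth_on_def using Ck_on_cong[OF assms] by auto

lemma smooth_on_local:
  assumes "\<And>x. x \<in> S \<Longrightarrow> \<exists>T. open T \<and> x \<in> T \<and> smooth_on T f"
  shows "smooth_on S f"
  unfolding smooth_on_def
  by (intro allI Ck_on_local) (meson assms smooth_on_def)

lemma smooth_on_const [simp]: "smooth_on S (\<lambda>x. c)"
  by (simp add: smooth_on_def)

lemma smooth_on_bounded_linear: "bounded_linear f \<Longrightarrow> smooth_on S f"
  by (simp add: smooth_on_def Ck_on_bounded_linear)

lemma smooth_on_linear_comp: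
  "open S \<Longrightarrow> bounded_linear L \<Longrightarrow> smooth_on S f \<Longrightarrow> smooth_on S (\<lambda>x. L (f x))"
  by (simp add: smooth_on_def Ck_on_linear_comp)

lemma smooth_on_affine_precomp:
  "open S \<Longrightarrow> bounded_linear L \<Longrightarrow> smooth_on S f \<Longrightarrow> smooth_on {x. L x + c \<in> S} (\<lambda>x. f (L x + c))"
  by (simp add: smooth_on_def Ck_on_affine_precomp)

lemma smooth_on_add:
  "open S \<Longrightarrow> smooth_on S f \<Longrightarrow> smooth_on S g \<Longrightarrow> smooth_on S (\<lambda>x. f x + g x)"
  by (simp add: smooth_on_def Ck_on_add)

lemma smooth_on_bilinear:
  "bounded_bilinear B \<Longrightarrow> open S \<Longrightarrow> smooth_on S f \<Longrightarrow> smooth_on S g \<Longrightarrow> smooth_on S (\<lambda>x. B (f x) (g x))"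
  by (simp add: smooth_on_def Ck_on_bilinear)

lemma smooth_on_compose:
  fixes f :: "'b::euclidean_space \<Rightarrow> 'c::real_normed_vector"
  shows "open S \<Longrightarrow> smooth_on T f \<Longrightarrow> smooth_on S g \<Longrightarrow> g ` S \<subseteq> T \<Longrightarrow> smooth_on S (\<lambda>x. f (g x))"
  unfolding smooth_on_def using Ck_on_compose by blast

lemma smooth_on_differentiable: "smooth_on S f \<Longrightarrow> x \<in> S \<Longrightarrow> f differentiable (at x)"
  unfolding smooth_on_def using Ck_on.simps(2)[of 0 S f] by blast

lemma smooth_on_has_derivative:
  "smooth_on S f \<Longrightarrow> x \<in> S \<Longrightarrow> (f has_derivative frechet_derivative f (at x)) (at x)"
  using smooth_on_differentiable frechet_derivative_works by blast

lemma smooth_on_directional_derivative: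
  "smooth_on S f \<Longrightarrow> smooth_on S (\<lambda>x. frechet_derivative f (at x) v)"
  unfolding smooth_on_def using Ck_on.simps(2)[of _ S f] by blast

lemma smooth_on_continuous_on: "smooth_on S f \<Longrightarrow> continuous_on S f"
  unfolding smooth_on_def using Ck_on.simps(1) by blast

lemma smooth_on_id: "smooth_on S (\<lambda>x. x)"
  using smooth_on_bounded_linear[OF bounded_linear_ident] .

section \<open>Smooth maps between manifolds\<close>

text \<open>The topological content of \<open>smooth_atlas\<close>, split off because it passes to
  product atlases without a computation of transition maps.\<close>

definition chart_atlas :: "('m::topological_space, 'e::real_normed_vector) chart set \<Rightarrow> bool" where
  "chart_atlas A \<longleftrightarrow>
     (\<forall>(U, \<phi>)\<in>A. open U \<and> open (\<phi> ` U) \<and> homeomorphism U (\<phi> ` U) \<phi> (inv_into U \<phi>)) \<and>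
     (\<Union>(U, \<phi>)\<in>A. U) = UNIV"

lemma smooth_atlas_charts: "smooth_atlas A \<Longrightarrow> chart_atlas A"
  by (simp add: smooth_atlas_def chart_atlas_def)

lemma chart_atlasD:
  assumes "chart_atlas A" "(U, \<phi>) \<in> A"
  shows "open U" "open (\<phi> ` U)" "inj_on \<phi> U" "continuous_on U \<phi>" "continuous_on (\<phi> ` U) (inv_into U \<phi>)"
    "homeomorphism U (\<phi> ` U) \<phi> (inv_into U \<phi>)"
proof -
  have *: "open U \<and> open (\<phi> ` U) \<and> homeomorphism U (\<phi> ` U) \<phi> (inv_into U \<phi>)"
    using assms unfolding chart_atlas_def by blast
  then show "open U" "open (\<phi> ` U)" "continuous_on U \<phi>" "continuous_on (\<phi> ` U) (inv_into U \<phi>)"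
    "homeomorphism U (\<phi> ` U) \<phi> (inv_into U \<phi>)"
    by (auto simp: homeomorphism_def)
  show "inj_on \<phi> U"
    using * unfolding homeomorphism_def by (metis inj_on_inverseI)
qed

lemma chart_atlas_cover:
  assumes "chart_atlas A"
  obtains U \<phi> where "(U, \<phi>) \<in> A" "p \<in> U"
proof -
  have "p \<in> (\<Union>(U, \<phi>)\<in>A. U)"
    using assms unfolding chart_atlas_def by simp
  then obtain c where "c \<in> A" "p \<in> (case c of (U, \<phi>) \<Rightarrow> U)"
    by (rule UN_E)
  then show thesis
    using that by (cases c) simp
qed

lemma chart_open_image:
  assumes "chart_atlas A" "(U, \<phi>) \<in> A" "open W" "W \<subseteq> U"
  shows "open (\<phi> ` W)"
proof -
  have "openin (top_of_set (\<phi> ` U)) (\<phi> ` W)"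
    by (meson assms chart_atlasD(6) homeomorphism_imp_open_map openin_open_eq chart_atlasD(1) openin_subset open_subset)
  then show ?thesis
    using chart_atlasD(2)[OF assms(1,2)] openin_open_trans by blast
qed

lemma chart_atlas_std: "chart_atlas (std_atlas :: ('a::real_normed_vector, 'a) chart set)"
proof -
  have "inv_into UNIV id = (id :: 'a \<Rightarrow> 'a)"
    using inv_id by simp
  then show ?thesis
    by (auto simp: chart_atlas_def std_atlas_def homeomorphism_def)
qed

section \<open>Product atlases and compositions of smooth maps\<close>

lemma inv_into_map_prod:
  assumes "inj_on \<phi> U" "inj_on \<psi> V" "a \<in> \<phi> ` U" "b \<in> \<psi> ` V"
  shows "inv_into (U \<times> V) (map_prod \<phi> \<psi>) (a, b) = (inv_into U \<phi> a, inv_into V \<psi> b)"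
proof -
  have "inj_on (map_prod \<phi> \<psi>) (U \<times> V)"
    using assms by (auto simp: inj_on_def)
  moreover have "(inv_into U \<phi> a, inv_into V \<psi> b) \<in> U \<times> V"
    "map_prod \<phi> \<psi> (inv_into U \<phi> a, inv_into V \<psi> b) = (a, b)"
    using assms by (auto intro: inv_into_into simp: f_inv_into_f)
  ultimately show ?thesis
    by (metis inv_into_f_eq)
qed

lemma map_prod_image_times: "map_prod \<phi> \<psi> ` (U \<times> V) = (\<phi> ` U) \<times> (\<psi> ` V)"
  by force

lemma chart_atlas_prod:
  assumes "chart_atlas A" "chart_atlas B"
  shows "chart_atlas (prod_atlas A B)"
  unfolding chart_atlas_def
proof (intro conjI ballI)
  fix c assume "c \<in> prod_atlas A B"
  then obtain U \<phi> V \<psi> where c: "c = (U \<times> V, map_prod \<phi> \<psi>)" "(U, \<phi>) \<in> A" "(V, \<psi>) \<in> B"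
    by (auto simp: prod_atlas_def)
  note U = chart_atlasD[OF assms(1) c(2)] and V = chart_atlasD[OF assms(2) c(3)]
  have "continuous_on (U \<times> V) (map_prod \<phi> \<psi>)"
    unfolding map_prod_def case_prod_beta
    by (intro continuous_intros continuous_on_compose2[OF U(4)] continuous_on_compose2[OF V(4)]) auto
  moreover have "continuous_on (\<phi> ` U \<times> \<psi> ` V) (\<lambda>z. (inv_into U \<phi> (fst z), inv_into V \<psi> (snd z)))"
    by (intro continuous_intros continuous_on_compose2[OF U(5)] continuous_on_compose2[OF V(5)]) auto
  then have "continuous_on (\<phi> ` U \<times> \<psi> ` V) (inv_into (U \<times> V) (map_prod \<phi> \<psi>))"
    by (rule continuous_on_eq) (auto simp: inv_into_map_prod U(3) V(3))
  ultimately have "homeomorphism (U \<times> V) (\<phi> ` U \<times> \<psi> ` V) (map_prod \<phi> \<psi>) (inv_into (U \<times> V) (map_prod \<phi> \<psi>))"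
    using U(3) V(3)
    by (intro homeomorphismI) (auto simp: inv_into_map_prod inv_into_into f_inv_into_f)
  then show "case c of (U, \<phi>) \<Rightarrow> open U \<and> open (\<phi> ` U) \<and> homeomorphism U (\<phi> ` U) \<phi> (inv_into U \<phi>)"
    using U V by (simp add: c map_prod_image_times open_Times)
next
  show "(\<Union>(U, \<phi>)\<in>prod_atlas A B. U) = UNIV"
  proof (intro Set.set_eqI iffI UNIV_I)
    fix x :: "'a \<times> 'c"
    obtain U \<phi> V \<psi> where "(U, \<phi>) \<in> A" "fst x \<in> U" "(V, \<psi>) \<in> B" "snd x \<in> V"
      using assms by (metis chart_atlas_cover)
    moreover from this have "(U \<times> V, map_prod \<phi> \<psi>) \<in> prod_atlas A B"
      by (auto simp: prod_atlas_def)
    ultimately show "x \<in> (\<Union>(U, \<phi>)\<in>prod_atlas A B. U)"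
      by (intro UN_I[of "(U \<times> V, map_prod \<phi> \<psi>)"]) (auto simp: mem_Times_iff)
  qed
qed

lemma smooth_map_chart:
  "smooth_map A B f \<Longrightarrow> (U, \<phi>) \<in> A \<Longrightarrow> (V, \<psi>) \<in> B \<Longrightarrow>
    smooth_on (\<phi> ` (U \<inter> f -` V)) (\<psi> \<circ> f \<circ> inv_into U \<phi>)"
  unfolding smooth_map_def by blast

lemma smooth_map_continuous: "smooth_map A B f \<Longrightarrow> continuous_on UNIV f"
  by (simp add: smooth_map_def)

lemma open_chart_preimage:
  assumes "chart_atlas A" "(U, \<phi>) \<in> A" "continuous_on UNIV f" "open V"
  shows "open (\<phi> ` (U \<inter> f -` V))"
  by (rule chart_open_image[OF assms(1,2) open_Int[OF chart_atlasD(1)[OF assms(1,2)]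
      open_vimage[OF assms(4,3)]]]) simp

lemma smooth_map_compose:
  fixes A :: "('m::topological_space, 'e::real_normed_vector) chart set"
    and B :: "('n::topological_space, 'f::euclidean_space) chart set"
    and C :: "('l::topological_space, 'h::real_normed_vector) chart set"
  assumes A: "chart_atlas A" and B: "chart_atlas B" and C: "chart_atlas C"
    and f: "smooth_map A B f" and g: "smooth_map B C g"
  shows "smooth_map A C (\<lambda>x. g (f x))"
proof -
  have cf: "continuous_on UNIV f" and cg: "continuous_on UNIV g"
    using f g by (simp_all add: smooth_map_def)
  have cgf: "continuous_on UNIV (\<lambda>x. g (f x))"
    using continuous_on_compose2[OF cg cf] by simp
  have "smooth_on (\<phi> ` (U \<inter> (\<lambda>x. g (f x)) -` W)) (\<kappa> \<circ> (\<lambda>x. g (f x)) \<circ> inv_into U \<phi>)"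
    if U: "(U, \<phi>) \<in> A" and W: "(W, \<kappa>) \<in> C" for U \<phi> W \<kappa>
  proof (rule smooth_on_local)
    fix x assume "x \<in> \<phi> ` (U \<inter> (\<lambda>x. g (f x)) -` W)"
    then obtain p where p: "p \<in> U" "g (f p) \<in> W" "x = \<phi> p" by auto
    obtain V \<psi> where V: "(V, \<psi>) \<in> B" "f p \<in> V" using chart_atlas_cover[OF B] by metis
    \<comment> \<open>The part of the coordinate domain that \<open>f\<close> sends into the one
      chart \<open>V\<close>, so that the coordinate expression factors through
      \<open>\<psi>\<close>.\<close>
    define T where "T = \<phi> ` (U \<inter> f -` V \<inter> (\<lambda>x. g (f x)) -` W)"
    note inj = chart_atlasD(3)[OF A U]
    have "open T" unfolding T_def
      by (intro chart_open_image[OF A U] open_Int chart_atlasD(1)[OF A U] open_vimage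
          chart_atlasD(1)[OF B V(1)] chart_atlasD(1)[OF C W] cf cgf) auto
    have "smooth_on T (\<lambda>z. (\<kappa> \<circ> g \<circ> inv_into V \<psi>) ((\<psi> \<circ> f \<circ> inv_into U \<phi>) z))"
    proof (rule smooth_on_compose[OF \<open>open T\<close> smooth_map_chart[OF g V(1) W]])
      show "smooth_on T (\<psi> \<circ> f \<circ> inv_into U \<phi>)"
        by (rule smooth_on_subset[OF smooth_map_chart[OF f U V(1)]]) (auto simp: T_def)
      show "(\<psi> \<circ> f \<circ> inv_into U \<phi>) ` T \<subseteq> \<psi> ` (V \<inter> g -` W)"
        using inj by (auto simp: T_def)
    qed
    then have "smooth_on T (\<kappa> \<circ> (\<lambda>x. g (f x)) \<circ> inv_into U \<phi>)"
    proof (rule smooth_on_cong[OF \<open>open T\<close>, THEN iffD1, rotated])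
      show "(\<kappa> \<circ> g \<circ> inv_into V \<psi>) ((\<psi> \<circ> f \<circ> inv_into U \<phi>) z) = (\<kappa> \<circ> (\<lambda>x. g (f x)) \<circ> inv_into U \<phi>) z"
        if "z \<in> T" for z
        using that inj chart_atlasD(3)[OF B V(1)] by (auto simp: T_def)
    qed
    moreover have "x \<in> T" using p V by (auto simp: T_def)
    ultimately show "\<exists>T. open T \<and> x \<in> T \<and> smooth_on T (\<kappa> \<circ> (\<lambda>x. g (f x)) \<circ> inv_into U \<phi>)"
      using \<open>open T\<close> by blast
  qed
  then show ?thesis
    using cgf by (auto simp: smooth_map_def)
qed

text \<open>Puts joint smoothness into the form used later, with the inverse of a product chart
  split into the inverses of its factors.\<close>

lemma smooth_map_prod_chart:
  assumes A: "chart_atlas A" and B: "chart_atlas B" and C: "chart_atlas C"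
    and F: "smooth_map (prod_atlas A B) C F"
    and U: "(U, \<phi>) \<in> A" and V: "(V, \<psi>) \<in> B" and W: "(W, \<kappa>) \<in> C"
  shows "open {z \<in> \<phi> ` U \<times> \<psi> ` V. F (inv_into U \<phi> (fst z), inv_into V \<psi> (snd z)) \<in> W}"
    and "smooth_on {z \<in> \<phi> ` U \<times> \<psi> ` V. F (inv_into U \<phi> (fst z), inv_into V \<psi> (snd z)) \<in> W}
      (\<lambda>z. \<kappa> (F (inv_into U \<phi> (fst z), inv_into V \<psi> (snd z))))"
proof -
  let ?S = "{z \<in> \<phi> ` U \<times> \<psi> ` V. F (inv_into U \<phi> (fst z), inv_into V \<psi> (snd z)) \<in> W}"
  note P = chart_atlas_prod[OF A B]
  have UV: "(U \<times> V, map_prod \<phi> \<psi>) \<in> prod_atlas A B"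
    using U V by (auto simp: prod_atlas_def)
  note i = chart_atlasD(3)[OF A U] chart_atlasD(3)[OF B V]
  have eq: "map_prod \<phi> \<psi> ` (U \<times> V \<inter> F -` W) = ?S"
  proof (intro Set.set_eqI iffI)
    fix z assume "z \<in> ?S"
    then show "z \<in> map_prod \<phi> \<psi> ` (U \<times> V \<inter> F -` W)"
      by (intro image_eqI[of _ _ "(inv_into U \<phi> (fst z), inv_into V \<psi> (snd z))"])
         (auto simp: f_inv_into_f inv_into_into i)
  qed (auto simp: i)
  show op: "open ?S"
    unfolding eq[symmetric]
    by (rule open_chart_preimage[OF P UV smooth_map_continuous[OF F] chart_atlasD(1)[OF C W]])
  have "smooth_on ?S (\<kappa> \<circ> F \<circ> inv_into (U \<times> V) (map_prod \<phi> \<psi>))"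
    using smooth_map_chart[OF F UV W] unfolding eq .
  then show "smooth_on ?S (\<lambda>z. \<kappa> (F (inv_into U \<phi> (fst z), inv_into V \<psi> (snd z))))"
    by (subst smooth_on_cong[OF op, where g = "\<kappa> \<circ> F \<circ> inv_into (U \<times> V) (map_prod \<phi> \<psi>)"])
       (auto simp: inv_into_map_prod[OF i])
qed

section \<open>Restriction of maps on products to slices\<close>

lemma smooth_on_Pair_left:
  assumes "open S" "smooth_on S H"
  shows "open {z. (z, c) \<in> S}" "smooth_on {z. (z, c) \<in> S} (\<lambda>z. H (z, c))"
proof -
  have "bounded_linear (\<lambda>z. (z, 0))"
    by (intro bounded_linear_Pair bounded_linear_ident bounded_linear_zero)
  from smooth_on_affine_precomp[OF assms(1) this assms(2), of "(0, c)"]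
  show "smooth_on {z. (z, c) \<in> S} (\<lambda>z. H (z, c))" by simp
  show "open {z. (z, c) \<in> S}"
    using open_vimage[OF assms(1), of "\<lambda>z. (z, c)"] by (simp add: vimage_def continuous_on_Pair)
qed

lemma smooth_on_Pair_right:
  assumes "open S" "smooth_on S H"
  shows "open {z. (c, z) \<in> S}" "smooth_on {z. (c, z) \<in> S} (\<lambda>z. H (c, z))"
proof -
  have "bounded_linear (\<lambda>z. (0, z))"
    by (intro bounded_linear_Pair bounded_linear_ident bounded_linear_zero)
  from smooth_on_affine_precomp[OF assms(1) this assms(2), of "(c, 0)"]
  show "smooth_on {z. (c, z) \<in> S} (\<lambda>z. H (c, z))" by simp
  show "open {z. (c, z) \<in> S}"
    using open_vimage[OF assms(1), of "\<lambda>z. (c, z)"] by (simp add: vimage_def continuous_on_Pair)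
qed

lemma smooth_map_slice_right:
  assumes A: "chart_atlas A" and B: "chart_atlas B" and C: "chart_atlas C"
    and F: "smooth_map (prod_atlas A B) C F"
  shows "smooth_map B C (\<lambda>q. F (p, q))"
proof -
  have cont: "continuous_on UNIV (\<lambda>q. F (p, q))"
    by (rule continuous_on_compose2[OF smooth_map_continuous[OF F]]) (auto intro!: continuous_intros)
  have "smooth_on (\<psi> ` (V \<inter> (\<lambda>q. F (p, q)) -` W)) (\<kappa> \<circ> (\<lambda>q. F (p, q)) \<circ> inv_into V \<psi>)"
    if V: "(V, \<psi>) \<in> B" and W: "(W, \<kappa>) \<in> C" for V \<psi> W \<kappa>
  proof -
    obtain U \<phi> where U: "(U, \<phi>) \<in> A" "p \<in> U" using chart_atlas_cover[OF A] by metis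
    note i = chart_atlasD(3)[OF A U(1)] chart_atlasD(3)[OF B V]
    have "smooth_on (\<psi> ` (V \<inter> (\<lambda>q. F (p, q)) -` W)) (\<lambda>z. \<kappa> (F (inv_into U \<phi> (\<phi> p), inv_into V \<psi> z)))"
      by (rule smooth_on_subset[OF smooth_on_Pair_right(2)[OF smooth_map_prod_chart[OF A B C F U(1) V W],
            of "\<phi> p", unfolded fst_conv snd_conv]]) (auto simp: i U f_inv_into_f inv_into_into)
    then show ?thesis
      using i U by (simp add: o_def)
  qed
  then show ?thesis using cont by (auto simp: smooth_map_def)
qed

lemma smooth_map_slice_left:
  assumes A: "chart_atlas A" and B: "chart_atlas B" and C: "chart_atlas C"
    and F: "smooth_map (prod_atlas A B) C F"
  shows "smooth_map A C (\<lambda>p. F (p, q))"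
proof -
  have cont: "continuous_on UNIV (\<lambda>p. F (p, q))"
    by (rule continuous_on_compose2[OF smooth_map_continuous[OF F]]) (auto intro!: continuous_intros)
  have "smooth_on (\<phi> ` (U \<inter> (\<lambda>p. F (p, q)) -` W)) (\<kappa> \<circ> (\<lambda>p. F (p, q)) \<circ> inv_into U \<phi>)"
    if U: "(U, \<phi>) \<in> A" and W: "(W, \<kappa>) \<in> C" for U \<phi> W \<kappa>
  proof -
    obtain V \<psi> where V: "(V, \<psi>) \<in> B" "q \<in> V" using chart_atlas_cover[OF B] by metis
    note i = chart_atlasD(3)[OF A U] chart_atlasD(3)[OF B V(1)]
    have "smooth_on (\<phi> ` (U \<inter> (\<lambda>p. F (p, q)) -` W)) (\<lambda>z. \<kappa> (F (inv_into U \<phi> z, inv_into V \<psi> (\<psi> q))))"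
      by (rule smooth_on_subset[OF smooth_on_Pair_left(2)[OF smooth_map_prod_chart[OF A B C F U V(1) W],
            of "\<psi> q", unfolded fst_conv snd_conv]]) (auto simp: i V f_inv_into_f inv_into_into)
    then show ?thesis
      using i V by (simp add: o_def)
  qed
  then show ?thesis using cont by (auto simp: smooth_map_def)
qed

text \<open>The target has a single global chart, and continuity follows from smoothness in the
  charts, since these cover the manifold by open sets.\<close>

lemma smooth_functions_iff:
  fixes A :: "('m::topological_space, 'e::real_normed_vector) chart set"
  assumes "chart_atlas A"
  shows "f \<in> smooth_functions A \<longleftrightarrow> (\<forall>(U, \<phi>)\<in>A. smooth_on (\<phi> ` U) (\<lambda>z. f (inv_into U \<phi> z)))"
proof -
  have "continuous_on UNIV f" if *: "\<forall>(U, \<phi>)\<in>A. smooth_on (\<phi> ` U) (\<lambda>z. f (inv_into U \<phi> z))"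
  proof -
    have "continuous_on U f" if U: "(U, \<phi>) \<in> A" for U \<phi>
    proof -
      note i = chart_atlasD[OF assms U]
      have "continuous_on U (\<lambda>x. f (inv_into U \<phi> (\<phi> x)))"
        by (rule continuous_on_compose2[OF smooth_on_continuous_on i(4), of "\<phi> ` U"]) (use * U in auto)
      then show ?thesis
        by (rule continuous_on_eq) (use i in auto)
    qed
    then have "continuous_on (\<Union>(fst ` A)) f"
      using chart_atlasD(1)[OF assms] by (intro continuous_on_open_Union) auto
    moreover have "\<Union>(fst ` A) = UNIV"
      using assms unfolding chart_atlas_def by (simp add: case_prod_beta)
    ultimately show ?thesis by simp
  qed
  then show ?thesis
    by (auto simp: smooth_functions_def smooth_map_def std_atlas_def o_def)
qed

lemma smooth_functions_lincomb:
  fixes f h :: "'m::topological_space \<Rightarrow> real"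
  assumes A: "chart_atlas A" and "f \<in> smooth_functions A" "h \<in> smooth_functions A"
  shows "(\<lambda>p. s * f p + t * h p) \<in> smooth_functions A"
proof -
  have "smooth_on (\<phi> ` U) (\<lambda>z. s * f (inv_into U \<phi> z) + t * h (inv_into U \<phi> z))" if "(U, \<phi>) \<in> A" for U \<phi>
    using assms(2,3) that chart_atlasD(2)[OF A that] unfolding smooth_functions_iff[OF A]
    by (intro smooth_on_add[OF _ smooth_on_linear_comp[OF _ bounded_linear_mult_right]
        smooth_on_linear_comp[OF _ bounded_linear_mult_right]]) blast+
  then show ?thesis unfolding smooth_functions_iff[OF A] by blast
qed

lemma smooth_functions_mult:
  fixes f h :: "'m::topological_space \<Rightarrow> real"
  assumes A: "chart_atlas A" and "f \<in> smooth_functions A" "h \<in> smooth_functions A"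
  shows "(\<lambda>p. f p * h p) \<in> smooth_functions A"
proof -
  have "smooth_on (\<phi> ` U) (\<lambda>z. f (inv_into U \<phi> z) * h (inv_into U \<phi> z))" if "(U, \<phi>) \<in> A" for U \<phi>
    using assms(2,3) that chart_atlasD(2)[OF A that] unfolding smooth_functions_iff[OF A]
    by (intro smooth_on_bilinear[OF bounded_bilinear_mult]) blast+
  then show ?thesis unfolding smooth_functions_iff[OF A] by blast
qed

text \<open>The Hausdorff property makes the compact set \<open>?Q\<close> closed in the whole
  manifold. Hence \<open>U\<close> and the complement of \<open>?Q\<close> form an open cover; on
  the first a transition map gives smoothness, on the second the function vanishes.\<close>

lemma smooth_function_extend_zero:
  fixes A :: "('m::t2_space, 'e::euclidean_space) chart set"
  assumes A: "smooth_atlas A" and U: "(U, \<phi>) \<in> A" and K: "compact K" "K \<subseteq> \<phi> ` U"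
    and b: "smooth_on (\<phi> ` U) b" "\<And>z. z \<in> \<phi> ` U - K \<Longrightarrow> b z = 0"
  shows "(\<lambda>p. if p \<in> U then b (\<phi> p) else 0) \<in> smooth_functions A"
  unfolding smooth_functions_iff[OF smooth_atlas_charts[OF A]]
proof (intro ballI, clarify)
  fix V \<psi> assume V: "(V, \<psi>) \<in> A"
  note C = smooth_atlas_charts[OF A]
  note u = chart_atlasD[OF C U] and v = chart_atlasD[OF C V]
  let ?f = "\<lambda>p. if p \<in> U then b (\<phi> p) else 0"
  let ?Q = "inv_into U \<phi> ` K"
  have "compact ?Q"
    by (intro compact_continuous_image continuous_on_subset[OF u(5)] K)
  then have clQ: "closed ?Q" by (rule compact_imp_closed)
  have QU: "?Q \<subseteq> U" using K(2) by (auto intro: inv_into_into)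
  show "smooth_on (\<psi> ` V) (\<lambda>z. ?f (inv_into V \<psi> z))"
  proof (rule smooth_on_local)
    fix z assume "z \<in> \<psi> ` V"
    then obtain p where p: "p \<in> V" "z = \<psi> p" by auto
    show "\<exists>T. open T \<and> z \<in> T \<and> smooth_on T (\<lambda>z. ?f (inv_into V \<psi> z))"
    proof (cases "p \<in> U")
      case True
      have op: "open (\<psi> ` (V \<inter> U))"
        by (intro chart_open_image[OF C V] open_Int u v) auto
      have tr: "smooth_on (\<psi> ` (V \<inter> U)) (\<phi> \<circ> inv_into V \<psi>)"
        using A U V unfolding smooth_atlas_def by blast
      have "smooth_on (\<psi> ` (V \<inter> U)) (\<lambda>z. b ((\<phi> \<circ> inv_into V \<psi>) z))"
        by (rule smooth_on_compose[OF op b(1) tr]) (use v in auto)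
      then have "smooth_on (\<psi> ` (V \<inter> U)) (\<lambda>z. ?f (inv_into V \<psi> z))"
        by (subst smooth_on_cong[OF op, where g = "\<lambda>z. b ((\<phi> \<circ> inv_into V \<psi>) z)"])
           (use v in auto)
      then show ?thesis using op p True by blast
    next
      case False
      have op: "open (\<psi> ` (V - ?Q))"
        by (intro chart_open_image[OF C V] open_Diff v clQ) auto
      have "smooth_on (\<psi> ` (V - ?Q)) (\<lambda>z. ?f (inv_into V \<psi> z))"
      proof (subst smooth_on_cong[OF op, where g = "\<lambda>z. 0"])
        fix y assume "y \<in> \<psi> ` (V - ?Q)"
        then obtain q where q: "q \<in> V" "q \<notin> ?Q" "y = \<psi> q" by auto
        have "b (\<phi> q) = 0" if "q \<in> U"
        proof (rule b(2), rule DiffI)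
          show "\<phi> q \<notin> K" using q(2) that u(3) by (metis image_eqI inv_into_f_f)
        qed (use that in auto)
        then show "?f (inv_into V \<psi> y) = 0"
          using q v(3) by auto
      qed simp
      moreover have "z \<in> \<psi> ` (V - ?Q)" using p False QU by auto
      ultimately show ?thesis using op by blast
    qed
  qed
qed

section \<open>Functions separating tangent vectors\<close>

text \<open>Derivatives of members are linear combinations of members, so smoothness of the case
  \<open>m = 0\<close>, the usual flat function, is proved by induction for all \<open>m\<close> at
  once.\<close>

definition flat_power :: "nat \<Rightarrow> real \<Rightarrow> real" where
  "flat_power m t = (if t > 0 then exp (- (1 / t)) / t ^ m else 0)"

lemma flat_power_limit: "((\<lambda>t. flat_power m t) \<longlongrightarrow> 0) (at 0)"
proof -
  have "((\<lambda>t::real. exp (- (1 / t)) / t ^ m) \<longlongrightarrow> 0) (at_right 0)"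
  proof -
    have "((\<lambda>t::real. inverse t ^ m / exp (inverse t)) \<longlongrightarrow> 0) (at_right 0)"
      by (rule filterlim_compose[OF tendsto_power_div_exp_0 filterlim_inverse_at_top_right])
    then show ?thesis
      by (simp add: exp_minus divide_simps power_inverse mult.commute)
  qed
  then have "((\<lambda>t. flat_power m t) \<longlongrightarrow> 0) (at_right 0)"
    by (rule Lim_transform_eventually)
       (rule eventually_mono[OF eventually_at_right_less], simp add: flat_power_def)
  moreover have "((\<lambda>t. flat_power m t) \<longlongrightarrow> 0) (at_left 0)"
    by (rule Lim_transform_eventually[OF tendsto_const])
       (auto simp: flat_power_def intro!: eventually_at_leftI[of "-1"])
  ultimately show ?thesis
    by (simp add: filterlim_at_split)
qed

lemma flat_power_has_derivative:
  "(flat_power m has_real_derivative (flat_power (m + 2) t - real m * flat_power (m + 1) t)) (at t)"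
proof -
  consider "t < 0" | "t = 0" | "t > 0" by linarith
  then show ?thesis
  proof cases
    case 1
    have "((\<lambda>x. 0) has_real_derivative (flat_power (m + 2) t - real m * flat_power (m + 1) t)) (at t)"
      using 1 by (simp add: flat_power_def)
    then show ?thesis
      by (rule has_field_derivative_transform_within_open[of _ _ _ "{..<0}"])
         (use 1 in \<open>auto simp: flat_power_def\<close>)
  next
    case 2
    \<comment> \<open>At 0 the difference quotient of one member is the next member of the family,
      whose limit is 0.\<close>
    have "flat_power (Suc m) h = flat_power m h / h" for h
      by (simp add: flat_power_def field_simps)
    then show ?thesis
      using flat_power_limit[of "Suc m"] by (simp add: 2 DERIV_def flat_power_def)
  next
    case 3
    have "((\<lambda>t. exp (- (1 / t)) / t ^ m) has_real_derivative
        (flat_power (m + 2) t - real m * flat_power (m + 1) t)) (at t)"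
    proof (rule DERIV_cong)
      show "((\<lambda>t. exp (- (1 / t)) / t ^ m) has_real_derivative
          (exp (- (1 / t)) / t ^ 2 * t ^ m - exp (- (1 / t)) * (real m * t ^ (m - 1))) / (t ^ m * t ^ m)) (at t)"
        using 3 by (auto intro!: derivative_eq_intros simp: power2_eq_square)
      have "real m * t ^ (m - 1) = real m * t ^ m / t"
        using 3 by (cases m) auto
      then show "(exp (- (1 / t)) / t ^ 2 * t ^ m - exp (- (1 / t)) * (real m * t ^ (m - 1))) / (t ^ m * t ^ m) =
          flat_power (m + 2) t - real m * flat_power (m + 1) t"
        using 3 by (simp add: flat_power_def power_add divide_simps power2_eq_square) (auto simp: algebra_simps)
    qed
    then show ?thesis
      by (rule has_field_derivative_transform_within_open[of _ _ _ "{0<..}"])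
         (use 3 in \<open>auto simp: flat_power_def\<close>)
  qed
qed

lemma flat_power_smooth: "smooth_on UNIV (flat_power m)"
proof -
  have "Ck_on k UNIV (flat_power m)" for k
  proof (induction k arbitrary: m)
    case 0
    then show ?case
      using flat_power_has_derivative by (auto intro!: continuous_at_imp_continuous_on DERIV_isCont)
  next
    case (Suc k)
    have d: "(flat_power m has_derivative
        (\<lambda>v. v *\<^sub>R flat_power (m + 2) t + (- (v * real m)) *\<^sub>R flat_power (m + 1) t)) (at t)" for t
      using flat_power_has_derivative[of m t, unfolded has_field_derivative_def]
      by (rule has_derivative_eq_rhs) (auto simp: algebra_simps)
    have "Ck_on k UNIV (\<lambda>t. v *\<^sub>R flat_power (m + 2) t + (- (v * real m)) *\<^sub>R flat_power (m + 1) t)" for v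
      by (intro Ck_on_add Ck_on_linear_comp[OF _ bounded_linear_scaleR_right] Suc.IH) auto
    then show ?case
      using differentiableI[OF d] by (simp flip: frechet_derivative_at[OF d])
  qed
  then show ?thesis by (simp add: smooth_on_def)
qed

text \<open>A linear function in coordinates times a bump. As the linear factor vanishes at
  \<open>p\<close>, only the value \<open>c\<close> of the bump there enters the derivative. With
  \<open>v\<close> the difference of two vectors, such an \<open>f\<close> tells them apart.\<close>

lemma separating_function:
  fixes A :: "('m::t2_space, 'e::euclidean_space) chart set"
  assumes A: "smooth_atlas A" and U: "(U, \<phi>) \<in> A" and p: "p \<in> U"
  obtains f c where "f \<in> smooth_functions A" "c > 0"
    "((\<lambda>z. f (inv_into U \<phi> z)) has_derivative (\<lambda>w. c * (w \<bullet> v))) (at (\<phi> p))"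
proof -
  note C = smooth_atlas_charts[OF A]
  note u = chart_atlasD[OF C U]
  obtain r where r: "r > 0" "cball (\<phi> p) r \<subseteq> \<phi> ` U"
    using u(2) p open_contains_cball by (metis image_eqI)
  \<comment> \<open>Positive exactly inside the open ball of radius \<open>r\<close>, so
    \<open>flat_power 0 (q z)\<close> vanishes off \<open>cball (\<phi> p) r\<close>, a compact
    subset of the chart image.\<close>
  define q where "q z = r\<^sup>2 + (- ((z - \<phi> p) \<bullet> (z - \<phi> p)))" for z
  define b where "b z = flat_power 0 (q z) * ((z - \<phi> p) \<bullet> v)" for z
  have sm1: "smooth_on UNIV (\<lambda>z. z - \<phi> p)"
    using smooth_on_affine_precomp[OF open_UNIV bounded_linear_ident smooth_on_id, of "- \<phi> p"] by simp
  have smq: "smooth_on UNIV q"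
    unfolding q_def
    by (intro smooth_on_add smooth_on_linear_comp[OF _ bounded_linear_minus[OF bounded_linear_ident]]
        smooth_on_bilinear[OF bounded_bilinear_inner] sm1 open_UNIV smooth_on_const)
  have smb: "smooth_on UNIV b"
    unfolding b_def
    by (intro smooth_on_bilinear[OF bounded_bilinear_mult] smooth_on_bilinear[OF bounded_bilinear_inner]
        smooth_on_compose[OF open_UNIV flat_power_smooth smq] sm1 open_UNIV smooth_on_const) auto
  have zero: "b z = 0" if "z \<notin> cball (\<phi> p) r" for z
  proof -
    have "r < norm (z - \<phi> p)" using that by (simp add: dist_norm norm_minus_commute)
    then have "r\<^sup>2 < (norm (z - \<phi> p))\<^sup>2" using r(1) by (intro power_strict_mono) auto
    then show ?thesis by (simp add: b_def q_def flat_power_def dot_square_norm)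
  qed
  define f where "f x = (if x \<in> U then b (\<phi> x) else 0)" for x
  have fs: "f \<in> smooth_functions A"
    unfolding f_def
    by (rule smooth_function_extend_zero[OF A U compact_cball r(2) smooth_on_subset[OF smb]])
       (use zero in auto)
  define c where "c = flat_power 0 (r\<^sup>2)"
  have c: "c > 0" using r by (simp add: c_def flat_power_def)
  have d1: "((\<lambda>z. flat_power 0 (q z)) has_derivative frechet_derivative (\<lambda>z. flat_power 0 (q z)) (at (\<phi> p))) (at (\<phi> p))"
    by (rule smooth_on_has_derivative[where S = UNIV],
        rule smooth_on_compose[OF open_UNIV flat_power_smooth smq]) auto
  have d2: "((\<lambda>z. (z - \<phi> p) \<bullet> v) has_derivative (\<lambda>w. w \<bullet> v)) (at (\<phi> p))"
    by (auto intro!: derivative_eq_intros)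
  have "(b has_derivative (\<lambda>w. c * (w \<bullet> v))) (at (\<phi> p))"
    unfolding b_def
    by (rule has_derivative_eq_rhs[OF has_derivative_mult[OF d1 d2]]) (auto simp: q_def c_def)
  then have "((\<lambda>z. f (inv_into U \<phi> z)) has_derivative (\<lambda>w. c * (w \<bullet> v))) (at (\<phi> p))"
    by (rule has_derivative_transform_within_open[OF _ u(2)])
       (use p u in \<open>auto simp: f_def\<close>)
  with fs c show ?thesis using that by blast
qed

section \<open>Left-invariant vector fields\<close>

lemma lie_group_smooth:
  assumes "lie_group G A"
  shows "smooth_map A A (\<lambda>h. g \<otimes>\<^bsub>G\<^esub> h)" "smooth_map A A (\<lambda>h. h \<otimes>\<^bsub>G\<^esub> g)"
    "smooth_atlas A" "chart_atlas A" "group G" "carrier G = UNIV"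
    "smooth_map (prod_atlas A A) A (\<lambda>(g, h). g \<otimes>\<^bsub>G\<^esub> h)"
proof -
  show *: "smooth_atlas A" "chart_atlas A" "group G" "carrier G = UNIV"
    "smooth_map (prod_atlas A A) A (\<lambda>(g, h). g \<otimes>\<^bsub>G\<^esub> h)"
    using assms smooth_atlas_charts by (auto simp: lie_group_def)
  show "smooth_map A A (\<lambda>h. g \<otimes>\<^bsub>G\<^esub> h)" "smooth_map A A (\<lambda>h. h \<otimes>\<^bsub>G\<^esub> g)"
    using smooth_map_slice_right[OF *(2) *(2) *(2) *(5), of g]
      smooth_map_slice_left[OF *(2) *(2) *(2) *(5), of g] by simp_all
qed

lemma smooth_functions_compose:
  fixes A :: "('m::topological_space, 'e::real_normed_vector) chart set"
    and B :: "('n::topological_space, 'f::euclidean_space) chart set"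
  assumes "chart_atlas A" "chart_atlas B" "smooth_map A B F" "f \<in> smooth_functions B"
  shows "(\<lambda>x. f (F x)) \<in> smooth_functions A"
  using assms smooth_map_compose[OF assms(1,2) chart_atlas_std assms(3)]
  by (simp add: smooth_functions_def)

text \<open>The tangent vector at the unit with coordinates \<open>v\<close>, pushed to each
  \<open>g\<close> by left translation.\<close>

definition left_invariant_field ::
    "'g::{t2_space,second_countable_topology} monoid \<Rightarrow> ('g, 'e::euclidean_space) chart set \<Rightarrow>
     'g set \<Rightarrow> ('g \<Rightarrow> 'e) \<Rightarrow> 'e \<Rightarrow> ('g \<Rightarrow> real) \<Rightarrow> 'g \<Rightarrow> real" where
  "left_invariant_field G A U \<phi> v = (\<lambda>f\<in>smooth_functions A. \<lambda>g.
     frechet_derivative (\<lambda>z. f (g \<otimes>\<^bsub>G\<^esub> inv_into U \<phi> z)) (at (\<phi> \<one>\<^bsub>G\<^esub>)) v)"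

text \<open>The point at issue is that \<open>X f\<close> is again smooth. In coordinates it is a
  partial derivative, at \<open>?e\<close> in the second argument, of the map \<open>H\<close>,
  which is smooth in both arguments together because multiplication is.\<close>

lemma left_invariant_field_in_lie_algebra:
  fixes G :: "'g::{t2_space,second_countable_topology} monoid" and A :: "('g, 'e::euclidean_space) chart set"
  assumes G: "lie_group G A" and U: "(U, \<phi>) \<in> A" and one: "\<one>\<^bsub>G\<^esub> \<in> U"
  shows "left_invariant_field G A U \<phi> v \<in> lie_algebra G A"
proof -
  define X where "X = left_invariant_field G A U \<phi> v"
  note X_def = X_def[unfolded left_invariant_field_def]
  note L = lie_group_smooth[OF G]
  interpret group G by (rule L(5))
  note u = chart_atlasD[OF L(4) U]
  let ?e = "\<phi> \<one>\<^bsub>G\<^esub>"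
  have e: "?e \<in> \<phi> ` U" using one by auto
  let ?D = "\<lambda>f g. frechet_derivative (\<lambda>z. f (g \<otimes>\<^bsub>G\<^esub> inv_into U \<phi> z)) (at ?e)"
  have fL: "(\<lambda>h. f (g \<otimes>\<^bsub>G\<^esub> h)) \<in> smooth_functions A" if "f \<in> smooth_functions A" for f g
    by (rule smooth_functions_compose[OF L(4) L(4) L(1) that])
  have d: "((\<lambda>z. f (g \<otimes>\<^bsub>G\<^esub> inv_into U \<phi> z)) has_derivative ?D f g) (at ?e)"
    if "f \<in> smooth_functions A" for f g
    using fL[OF that, of g] U e unfolding smooth_functions_iff[OF L(4)]
    by (auto intro!: smooth_on_has_derivative)
  have Xs: "X f \<in> smooth_functions A" if f: "f \<in> smooth_functions A" for f
    unfolding smooth_functions_iff[OF L(4)]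
  proof (intro ballI, clarify)
    fix V \<psi> assume V: "(V, \<psi>) \<in> A"
    note v = chart_atlasD[OF L(4) V]
    have fm: "smooth_map (prod_atlas A A) std_atlas (\<lambda>x. f (case x of (g, h) \<Rightarrow> g \<otimes>\<^bsub>G\<^esub> h))"
      using smooth_functions_compose[OF chart_atlas_prod[OF L(4) L(4)] L(4) L(7) f]
      by (simp add: smooth_functions_def)
    define H where "H z = f (inv_into V \<psi> (fst z) \<otimes>\<^bsub>G\<^esub> inv_into U \<phi> (snd z))" for z
    have op: "open (\<psi> ` V \<times> \<phi> ` U)" using u v open_Times by blast
    have H: "smooth_on (\<psi> ` V \<times> \<phi> ` U) H"
      using smooth_map_prod_chart(2)[OF L(4) L(4) chart_atlas_std fm V U, of UNIV id]
      by (simp add: std_atlas_def H_def[abs_def])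
    have "smooth_on {z. (z, ?e) \<in> \<psi> ` V \<times> \<phi> ` U} (\<lambda>z. frechet_derivative H (at (z, ?e)) (0, v))"
      by (rule smooth_on_Pair_left(2)[OF op smooth_on_directional_derivative[OF H]])
    moreover have "frechet_derivative H (at (z, ?e)) (0, v) = X f (inv_into V \<psi> z)" if "z \<in> \<psi> ` V" for z
    proof -
      have "(H has_derivative frechet_derivative H (at (z, ?e))) (at (z, ?e))"
        using that e by (intro smooth_on_has_derivative[OF H]) auto
      moreover have "((\<lambda>y. (z, y)) has_derivative (\<lambda>y. (0, y))) (at ?e)"
        by (auto intro!: derivative_eq_intros)
      ultimately have "((\<lambda>y. H (z, y)) has_derivative (\<lambda>y. frechet_derivative H (at (z, ?e)) (0, y))) (at ?e)"
        by (rule has_derivative_compose[rotated])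
      then show ?thesis
        using f by (simp add: X_def H_def frechet_derivative_at[symmetric])
    qed
    ultimately show "smooth_on (\<psi> ` V) (\<lambda>z. X f (inv_into V \<psi> z))"
      using smooth_on_cong[OF v(2), of "\<lambda>z. frechet_derivative H (at (z, ?e)) (0, v)"] e by simp
  qed
  have Xlin: "X (\<lambda>p. s * f p + t * h p) = (\<lambda>p. s * X f p + t * X h p)"
    if "f \<in> smooth_functions A" "h \<in> smooth_functions A" for f h s t
  proof
    fix p
    have "((\<lambda>z. s * f (p \<otimes>\<^bsub>G\<^esub> inv_into U \<phi> z) + t * h (p \<otimes>\<^bsub>G\<^esub> inv_into U \<phi> z))
        has_derivative (\<lambda>w. s * ?D f p w + t * ?D h p w)) (at ?e)"
      by (intro has_derivative_add has_derivative_mult_right d that)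
    then show "X (\<lambda>p. s * f p + t * h p) p = s * X f p + t * X h p"
      using that smooth_functions_lincomb[OF L(4) that]
      by (simp add: X_def frechet_derivative_at[symmetric])
  qed
  have Xmul: "X (\<lambda>p. f p * h p) = (\<lambda>p. f p * X h p + h p * X f p)"
    if "f \<in> smooth_functions A" "h \<in> smooth_functions A" for f h
  proof
    fix p
    have "((\<lambda>z. f (p \<otimes>\<^bsub>G\<^esub> inv_into U \<phi> z) * h (p \<otimes>\<^bsub>G\<^esub> inv_into U \<phi> z))
        has_derivative (\<lambda>w. f (p \<otimes>\<^bsub>G\<^esub> inv_into U \<phi> ?e) * ?D h p w + ?D f p w * h (p \<otimes>\<^bsub>G\<^esub> inv_into U \<phi> ?e))) (at ?e)"
      by (intro has_derivative_mult d that)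
    then show "X (\<lambda>p. f p * h p) p = f p * X h p + h p * X f p"
      using that smooth_functions_mult[OF L(4) that] u(3) one
      by (simp add: X_def frechet_derivative_at[symmetric] L(6))
  qed
  have "X (\<lambda>p. f (g \<otimes>\<^bsub>G\<^esub> p)) = (\<lambda>p. X f (g \<otimes>\<^bsub>G\<^esub> p))" if "f \<in> smooth_functions A" for f g
    using that fL[OF that] by (simp add: X_def m_assoc L(6))
  moreover have "X \<in> smooth_functions A \<rightarrow>\<^sub>E smooth_functions A"
    using Xs by (auto simp: X_def)
  ultimately show ?thesis
    using Xlin Xmul unfolding lie_algebra_def vector_fields_def X_def left_invariant_field_def by blast
qed

section \<open>Finite-dimensional normed spaces inside Euclidean spaces\<close>

text \<open>
  The Euclidean space only lends its theorems (the inverse function theorem, invariance of domain,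
  dimension theory) to the normed space, which is not an instance of \<^class>\<open>euclidean_space\<close>.
\<close>

locale embedded_space =
  fixes j :: "'v::real_normed_vector \<Rightarrow> 'e::euclidean_space" and r :: "'e \<Rightarrow> 'v"
  assumes bounded_linear_j: "bounded_linear j" and bounded_linear_r: "bounded_linear r"
    and r_j [simp]: "r (j x) = x"
begin

lemma linear_j: "linear j" and linear_r: "linear r"
  using bounded_linear_j bounded_linear_r bounded_linear.linear by auto

lemma inj_j: "inj j"
  by (metis injI r_j)

text \<open>The map is \<open>f \<circ> r\<close> after \<open>j\<close>, and the linear map
  \<open>f \<circ> r\<close> is bounded because its domain is Euclidean.\<close>

lemma bounded_linear_of_linear:
  fixes f :: "'v \<Rightarrow> 'w::real_normed_vector"
  assumes "linear f"
  shows "bounded_linear f"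
proof -
  have "bounded_linear (f \<circ> r)"
    using linear_compose[OF linear_r assms] linear_conv_bounded_linear by blast
  then have "bounded_linear (\<lambda>x. (f \<circ> r) (j x))"
    by (rule bounded_linear_compose[OF _ bounded_linear_j])
  then show ?thesis by simp
qed

lemma subspace_j_image: "subspace S \<Longrightarrow> subspace (j ` S)"
  using linear_j by (rule linear_subspace_image)

text \<open>Dimensions in \<open>'v\<close> are measured on images under \<open>j\<close>, and
  \<open>L\<close> is replaced by the endomorphism \<open>j \<circ> L \<circ> r\<close> of the
  Euclidean space.\<close>

lemma dim_j_linear_image_le:
  assumes "linear L"
  shows "dim (j ` L ` S) \<le> dim (j ` S)"
proof -
  have "linear (\<lambda>e. j (L (r e)))"
    using linear_compose[OF linear_compose[OF linear_r assms] linear_j] by (simp add: o_def)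
  then have "dim ((\<lambda>e. j (L (r e))) ` (j ` S)) \<le> dim (j ` S)"
    by (rule dim_image_le)
  then show ?thesis by (simp add: image_image)
qed

lemma dim_j_linear_image_eq:
  assumes "linear L" "inj_on L S" "subspace S"
  shows "dim (j ` L ` S) = dim (j ` S)"
proof -
  have "linear (\<lambda>e. j (L (r e)))"
    using linear_compose[OF linear_compose[OF linear_r assms(1)] linear_j] by (simp add: o_def)
  moreover have "inj_on (\<lambda>e. j (L (r e))) (span (j ` S))"
  proof -
    have sp: "span (j ` S) = j ` S"
      using subspace_j_image[OF assms(3)] span_eq_iff by blast
    show ?thesis
      unfolding sp using assms(2) by (simp add: inj_on_def inj_eq[OF inj_j])
  qed
  ultimately have "dim ((\<lambda>e. j (L (r e))) ` (j ` S)) = dim (j ` S)"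
    by (rule dim_image_eq)
  then show ?thesis by (simp add: image_image)
qed

lemma subspace_eq_of_dim:
  assumes "subspace S" "subspace T" "S \<subseteq> T" "dim (j ` T) \<le> dim (j ` S)"
  shows "S = T"
proof -
  have "j ` S = j ` T"
    using assms by (intro subspace_dim_equal subspace_j_image) auto
  then show ?thesis
    using inj_j inj_image_eq_iff by blast
qed

text \<open>Applied to \<open>j \<circ> f \<circ> r\<close>. Relatively open sets pass to the
  Euclidean space as preimages under \<open>r\<close> and return as preimages under
  \<open>j\<close>.\<close>

lemma invariance_of_domain:
  assumes "openin (top_of_set S) W" "subspace S" "subspace T" "dim (j ` T) \<le> dim (j ` S)"
    and "continuous_on W f" "f ` W \<subseteq> T" "inj_on f W"
  shows "openin (top_of_set T) (f ` W)"
proof -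
  have cj: "continuous_on X j" and cr: "continuous_on Y r" for X Y
    using bounded_linear_j bounded_linear_r by (auto intro: linear_continuous_on)
  have W: "W \<subseteq> S" using assms(1) openin_imp_subset by blast
  obtain O1 where O1: "open O1" "W = S \<inter> O1"
    using assms(1) by (auto simp: openin_open)
  have "openin (top_of_set (j ` S)) (j ` W)"
  proof -
    have "j ` W = j ` S \<inter> r -` O1"
      using O1(2) by auto
    moreover have "open (r -` O1)"
      using O1(1) cr[of UNIV] by (rule open_vimage)
    ultimately show ?thesis by (simp add: openin_open_Int)
  qed
  moreover have "continuous_on (j ` W) (\<lambda>e. j (f (r e)))"
    by (rule continuous_on_compose2[OF cj], rule continuous_on_compose2[OF assms(5) cr]) auto
  moreover have "(\<lambda>e. j (f (r e))) \<in> j ` W \<rightarrow> j ` T"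
    using assms(6) by auto
  moreover have "inj_on (\<lambda>e. j (f (r e))) (j ` W)"
    using assms(7) by (simp add: inj_on_def inj_eq[OF inj_j])
  ultimately have "openin (top_of_set (j ` T)) ((\<lambda>e. j (f (r e))) ` (j ` W))"
    by (rule invariance_of_domain_subspaces[OF _ subspace_j_image[OF assms(2)] subspace_j_image[OF assms(3)] assms(4)])
  then have "openin (top_of_set (j ` T)) (j ` f ` W)"
    by (simp add: image_image)
  then obtain O2 where O2: "open O2" "j ` f ` W = j ` T \<inter> O2"
    by (auto simp: openin_open)
  have "f ` W = T \<inter> j -` O2"
  proof (intro equalityI subsetI)
    fix x assume "x \<in> f ` W"
    then show "x \<in> T \<inter> j -` O2"
      using O2(2) assms(6) by auto
  next
    fix x assume "x \<in> T \<inter> j -` O2"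
    then have "j x \<in> j ` f ` W" unfolding O2(2) by simp
    then show "x \<in> f ` W" by (simp only: inj_image_mem_iff[OF inj_j])
  qed
  moreover have "open (j -` O2)"
    using O2(1) cj[of UNIV] by (rule open_vimage)
  ultimately show ?thesis
    by (simp add: openin_open_Int)
qed

text \<open>The map \<open>H\<close> extends \<open>F\<close> to the Euclidean space by adding the
  identity on the kernel of \<open>r\<close>, so its derivative at \<open>j x0\<close> is the
  identity and the Euclidean theorem applies. The local inverse of \<open>H\<close> sends points
  \<open>j y\<close> back into the range of \<open>j\<close> and therefore restricts to an inverse
  of \<open>F\<close>.\<close>

lemma inverse_function:
  fixes F :: "'v \<Rightarrow> 'v" and F' :: "'v \<Rightarrow> 'v \<Rightarrow> 'v"
  assumes U: "open U" "x0 \<in> U"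
    and F: "\<And>x. x \<in> U \<Longrightarrow> (F has_derivative F' x) (at x)"
    and F'_cont: "\<And>v. continuous_on U (\<lambda>x. F' x v)"
    and F'_x0: "\<And>v. F' x0 v = v"
  obtains Z N Q Q' where "open Z" "x0 \<in> Z" "Z \<subseteq> U" "open N" "F x0 \<in> N" "homeomorphism Z N F Q"
    "\<And>y. y \<in> N \<Longrightarrow> (Q has_derivative Q' y) (at y)"
    "\<And>y v. y \<in> N \<Longrightarrow> Q' y (F' (Q y) v) = v"
proof -
  have cj: "continuous_on X j" and cr: "continuous_on Y r" for X Y
    using bounded_linear_j bounded_linear_r by (auto intro: linear_continuous_on)
  interpret j: linear j by (rule linear_j)
  interpret r: linear r by (rule linear_r)
  define H where "H e = j (F (r e)) + (e - j (r e))" for e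
  define H' where "H' e h = j (F' (r e) (r h)) + (h - j (r h))" for e h
  have opU: "open (r -` U)"
    using U(1) cr[of UNIV] by (rule open_vimage)
  have dH: "(H has_derivative H' e) (at e)" if "e \<in> r -` U" for e
  proof -
    have dr: "(r has_derivative r) (at e)"
      by (rule bounded_linear_imp_has_derivative[OF bounded_linear_r])
    have "((\<lambda>e. F (r e)) has_derivative (\<lambda>h. F' (r e) (r h))) (at e)"
      using that by (intro has_derivative_compose[OF dr F]) auto
    then show ?thesis
      unfolding H_def[abs_def] H'_def
      by (intro has_derivative_add has_derivative_diff has_derivative_ident
          bounded_linear.has_derivative[OF bounded_linear_j] dr)
  qed
  have blH: "bounded_linear (H' e)" if "e \<in> r -` U" for e
    using dH[OF that] by (rule has_derivative_bounded_linear)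
  have contH: "continuous_on (r -` U) (\<lambda>e. H' e h)" for h
    unfolding H'_def
    by (intro continuous_on_add continuous_on_const continuous_on_compose2[OF cj]
        continuous_on_compose2[OF F'_cont cr]) auto
  let ?B = "\<lambda>e. Blinfun (H' e)"
  have apB: "blinfun_apply (?B e) = H' e" if "e \<in> r -` U" for e
    using bounded_linear_Blinfun_apply[OF blH[OF that]] .
  have contB: "continuous_on (r -` U) ?B"
  proof (rule continuous_on_blinfun_componentwise)
    fix i :: 'e
    show "continuous_on (r -` U) (\<lambda>e. blinfun_apply (?B e) i)"
      by (rule continuous_on_eq[OF contH[of i]]) (simp add: apB)
  qed
  have x0: "j x0 \<in> r -` U" using U by simp
  have inv0: "id_blinfun o\<^sub>L ?B (j x0) = id_blinfun"
    by (rule blinfun_eqI) (simp add: apB[OF x0], simp add: H'_def F'_x0)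
  obtain U' V g g' where I: "open U'" "U' \<subseteq> r -` U" "j x0 \<in> U'" "open V" "H (j x0) \<in> V"
    "homeomorphism U' V H g"
    "\<And>y. y \<in> V \<Longrightarrow> (g has_derivative (g' y)) (at y)"
    "\<And>y. y \<in> V \<Longrightarrow> g' y = inv_into UNIV (blinfun_apply (?B (g y)))"
    "\<And>y. y \<in> V \<Longrightarrow> bij (blinfun_apply (?B (g y)))"
  proof (rule inverse_function_theorem[OF opU _ contB x0 inv0])
    show "(H has_derivative blinfun_apply (?B e)) (at e)" if "e \<in> r -` U" for e
      using dH[OF that] apB[OF that] by simp
  qed blast
  have Hj: "H (j x) = j (F x)" for x by (simp add: H_def)
  let ?Q = "\<lambda>y. r (g (j y))"
  have gy: "g (j y) = j (?Q y)" "F (?Q y) = y" "j (?Q y) \<in> U'" if "j y \<in> V" for y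
  proof -
    have e: "g (j y) \<in> U'" "H (g (j y)) = j y"
      using I(6) that by (auto simp: homeomorphism_def)
    \<comment> \<open>\<open>r\<close> annihilates the correction term of \<open>H\<close>. Once
      \<open>F (?Q y) = y\<close> is known, the equation \<open>H (g (j y)) = j y\<close> forces
      that term to be 0, so \<open>g (j y)\<close> lies in the range of \<open>j\<close>.\<close>
    have "r (H (g (j y))) = F (r (g (j y)))"
      by (simp add: H_def r.add r.diff)
    then show F: "F (?Q y) = y" by (simp add: e)
    show "g (j y) = j (?Q y)"
      using e(2) by (simp add: H_def F)
    with e show "j (?Q y) \<in> U'" by simp
  qed
  have QF: "j (F x) \<in> V \<and> ?Q (F x) = x" if "j x \<in> U'" for x
    using that I(6) by (auto simp: homeomorphism_def simp flip: Hj)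
  show ?thesis
  proof (rule that[of "j -` U'" "j -` V" ?Q "\<lambda>y h. r (g' (j y) (j h))"])
    show "open (j -` U')" "open (j -` V)"
      using I(1,4) cj[of UNIV] by (auto intro: open_vimage)
    show "x0 \<in> j -` U'" "j -` U' \<subseteq> U" "F x0 \<in> j -` V"
      using I(2,3,5) Hj by auto
    show "homeomorphism (j -` U') (j -` V) F ?Q"
    proof (rule homeomorphismI)
      have "continuous_on U F"
        using F by (metis has_derivative_continuous_on has_derivative_at_withinI)
      then show "continuous_on (j -` U') F"
        by (rule continuous_on_subset) (use I(2) in auto)
      have "continuous_on V g" using I(6) by (simp add: homeomorphism_def)
      then show "continuous_on (j -` V) ?Q"
        by (intro continuous_on_compose2[OF cr] continuous_on_compose2[OF _ cj, of V g]) auto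
    qed (use gy QF in auto)
    show "(?Q has_derivative (\<lambda>h. r (g' (j y) (j h)))) (at y)" if "y \<in> j -` V" for y
    proof -
      have "(j has_derivative j) (at y)"
        by (rule bounded_linear_imp_has_derivative[OF bounded_linear_j])
      then have "((\<lambda>y. g (j y)) has_derivative (\<lambda>h. g' (j y) (j h))) (at y)"
        using that by (intro has_derivative_compose[OF _ I(7)]) auto
      then show ?thesis
        by (rule bounded_linear.has_derivative[OF bounded_linear_r])
    qed
    show "r (g' (j y) (j (F' (?Q y) v))) = v" if "y \<in> j -` V" for y v
    proof -
      have y: "j y \<in> V" using that by simp
      have "j (F' (?Q y) v) = H' (g (j y)) (j v)"
        by (subst gy(1)[OF y]) (simp add: H'_def)
      moreover have "g (j y) \<in> r -` U" using gy[OF y] I(2) by auto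
      ultimately show ?thesis
        using I(8,9)[OF y] by (simp add: apB bij_is_inj)
    qed
  qed
qed

end

section \<open>Orbit maps of a smooth action\<close>

text \<open>The group is modelled on the same \<open>'e\<close> that receives the vector space. One
  chart at the unit is fixed; other group elements are reached from it by translation.\<close>

locale smooth_action = embedded_space j r
  for j :: "'v::real_normed_vector \<Rightarrow> 'e::euclidean_space" and r :: "'e \<Rightarrow> 'v" +
  fixes G :: "'g::{t2_space,second_countable_topology} monoid" (structure)
    and A :: "('g, 'e) chart set" and act :: "'g \<Rightarrow> 'v \<Rightarrow> 'v"
    and U :: "'g set" and \<phi> :: "'g \<Rightarrow> 'e"
  assumes lie: "lie_group G A"
    and action: "group_action G UNIV act"
    and smooth: "smooth_map (prod_atlas A std_atlas) std_atlas (\<lambda>(g, x). act g x)"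
    and chart: "(U, \<phi>) \<in> A" and one_U: "\<one> \<in> U"
begin

sublocale group G
  using lie_group_smooth(5)[OF lie] .

lemma carrier_UNIV [simp]: "carrier G = UNIV"
  using lie_group_smooth(6)[OF lie] .

lemma act_mult: "act (g \<otimes> h) x = act g (act h x)"
  using group_action.composition_rule[OF action, of x g h] by simp

lemma act_one [simp]: "act \<one> x = x"
  using group_action.id_eq_one[OF action] by (metis UNIV_I restrict_apply)

lemmas charts = lie_group_smooth(4)[OF lie]
lemmas chartD = chart_atlasD[OF charts chart]

abbreviation param :: "'e \<Rightarrow> 'g" where "param \<equiv> inv_into U \<phi>"

abbreviation e1 :: 'e where "e1 \<equiv> \<phi> \<one>"

lemma param_chart [simp]: "g \<in> U \<Longrightarrow> param (\<phi> g) = g"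
  using chartD(3) by simp

lemma chart_param: "z \<in> \<phi> ` U \<Longrightarrow> \<phi> (param z) = z" "z \<in> \<phi> ` U \<Longrightarrow> param z \<in> U"
  by (simp_all add: f_inv_into_f inv_into_into)

lemma e1_in: "e1 \<in> \<phi> ` U"
  using one_U by simp

lemma param_e1: "param e1 = \<one>"
  using one_U by simp

abbreviation \<Psi> :: "'e \<times> 'v \<Rightarrow> 'v" where "\<Psi> w \<equiv> act (param (fst w)) (snd w)"

lemma \<Psi>_smooth: "smooth_on (\<phi> ` U \<times> UNIV) \<Psi>"
proof -
  have "(UNIV, id) \<in> (std_atlas :: ('v, 'v) chart set)"
    by (simp add: std_atlas_def)
  from smooth_map_prod_chart(2)[OF charts chart_atlas_std chart_atlas_std smooth chart this this]
  show ?thesis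
    by (simp add: inv_id[unfolded id_def] id_def)
qed

lemma open_domain: "open (\<phi> ` U \<times> (UNIV :: 'v set))"
  using chartD(2) by (simp add: open_Times)

abbreviation orbit_map :: "'v \<Rightarrow> 'e \<Rightarrow> 'v" where "orbit_map y z \<equiv> act (param z) y"

lemma orbit_map_smooth: "smooth_on (\<phi> ` U) (orbit_map y)"
  using smooth_on_Pair_left(2)[OF open_domain \<Psi>_smooth, of y] by simp

lemma orbit_map_has_derivative:
  "z \<in> \<phi> ` U \<Longrightarrow> (orbit_map y has_derivative frechet_derivative (orbit_map y) (at z)) (at z)"
  by (rule smooth_on_has_derivative[OF orbit_map_smooth])

lemma act_smooth: "smooth_on UNIV (act g)"
proof -
  have "smooth_map std_atlas std_atlas (act g)"
    using smooth_map_slice_right[OF charts chart_atlas_std chart_atlas_std smooth, of g] by simp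
  then show ?thesis
    by (simp add: smooth_map_def std_atlas_def o_def inv_id[unfolded id_def] id_def)
qed

text \<open>The infinitesimal action at \<open>y\<close>, with tangent vectors at the unit written
  in the coordinates of the chart.\<close>

definition T :: "'v \<Rightarrow> 'e \<Rightarrow> 'v" where
  "T y = frechet_derivative (orbit_map y) (at e1)"

definition D :: "'v \<Rightarrow> 'v set" where
  "D y = range (T y)"

lemma linear_T: "linear (T y)"
  unfolding T_def by (rule has_derivative_linear[OF orbit_map_has_derivative[OF e1_in]])

lemma T_has_derivative: "(orbit_map y has_derivative T y) (at e1)"
  unfolding T_def by (rule orbit_map_has_derivative[OF e1_in])

lemma subspace_D: "subspace (D y)"
  unfolding D_def using linear_subspace_image[OF linear_T subspace_UNIV] .

lemma chart_expression:
  assumes f: "smooth_map A A f" and g: "g \<in> U" "f g \<in> U"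
  obtains S \<kappa>' where "open S" "\<phi> g \<in> S" "S \<subseteq> \<phi> ` U" "\<And>z. z \<in> S \<Longrightarrow> f (param z) \<in> U"
    "((\<lambda>z. \<phi> (f (param z))) has_derivative \<kappa>') (at (\<phi> g))"
proof -
  let ?S = "\<phi> ` (U \<inter> f -` U)"
  have "open ?S"
    by (rule open_chart_preimage[OF charts chart smooth_map_continuous[OF f] chartD(1)])
  moreover have "\<phi> g \<in> ?S" "?S \<subseteq> \<phi> ` U" using g by auto
  moreover have "f (param z) \<in> U" if "z \<in> ?S" for z using that by auto
  moreover have "smooth_on ?S (\<lambda>z. \<phi> (f (param z)))"
    using smooth_map_chart[OF f chart chart] by (simp add: o_def)
  from smooth_on_has_derivative[OF this \<open>\<phi> g \<in> ?S\<close>]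
  have "((\<lambda>z. \<phi> (f (param z))) has_derivative
      frechet_derivative (\<lambda>z. \<phi> (f (param z))) (at (\<phi> g))) (at (\<phi> g))" .
  ultimately show ?thesis using that by metis
qed

text \<open>Near \<open>?h = param z\<close> the orbit map of \<open>y\<close> is the orbit map of
  the point \<open>orbit_map y z\<close> after right translation by \<open>inv ?h\<close>, which
  carries \<open>?h\<close> to the unit. The chain rule routes the derivative through
  \<open>T\<close> at that point.\<close>

lemma orbit_map_derivative_range:
  assumes z: "z \<in> \<phi> ` U"
  shows "frechet_derivative (orbit_map y) (at z) w \<in> D (orbit_map y z)"
proof -
  let ?h = "param z"
  have h: "?h \<in> U" "\<phi> ?h = z" using chart_param[OF z] by auto
  obtain S \<kappa>' where S: "open S" "\<phi> ?h \<in> S" "S \<subseteq> \<phi> ` U" "\<And>z. z \<in> S \<Longrightarrow> param z \<otimes> inv ?h \<in> U"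
    and \<kappa>: "((\<lambda>z. \<phi> (param z \<otimes> inv ?h)) has_derivative \<kappa>') (at (\<phi> ?h))"
    using chart_expression[OF lie_group_smooth(2)[OF lie, of "inv ?h"] h(1)] one_U by auto
  have "((\<lambda>z. orbit_map (orbit_map y (\<phi> ?h)) (\<phi> (param z \<otimes> inv ?h))) has_derivative
      (\<lambda>w. T (orbit_map y (\<phi> ?h)) (\<kappa>' w))) (at (\<phi> ?h))"
    using T_has_derivative[of "orbit_map y (\<phi> ?h)"] h(1)
    by (intro has_derivative_compose[OF \<kappa>]) simp
  then have "(orbit_map y has_derivative (\<lambda>w. T (orbit_map y (\<phi> ?h)) (\<kappa>' w))) (at (\<phi> ?h))"
  proof (rule has_derivative_transform_within_open[OF _ S(1,2)])
    fix x assume x: "x \<in> S"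
    have "orbit_map (orbit_map y (\<phi> ?h)) (\<phi> (param x \<otimes> inv ?h)) = act (param x \<otimes> inv ?h \<otimes> ?h) y"
      using S(4)[OF x] h(1) by (simp add: act_mult)
    also have "param x \<otimes> inv ?h \<otimes> ?h = param x"
      by (simp add: m_assoc)
    finally show "orbit_map (orbit_map y (\<phi> ?h)) (\<phi> (param x \<otimes> inv ?h)) = orbit_map y x" .
  qed
  then show ?thesis
    unfolding h(2) by (simp add: D_def frechet_derivative_at[symmetric])
qed

text \<open>Acting by \<open>k\<close> on \<open>act g y\<close> is acting by
  \<open>inv g \<otimes> k \<otimes> g\<close> on \<open>y\<close> and then by \<open>g\<close>;
  this is differentiated in \<open>k\<close> at the unit, which conjugation fixes. For
  \<open>rank_act\<close> the inclusion is applied to \<open>g\<close> and to its inverse.\<close>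

lemma D_equivariant: "D (act g y) \<subseteq> frechet_derivative (act g) (at y) ` D y"
proof -
  have sm: "smooth_map A A (\<lambda>h. inv g \<otimes> h \<otimes> g)"
    by (rule smooth_map_compose[OF charts charts charts lie_group_smooth(1)[OF lie] lie_group_smooth(2)[OF lie]])
  obtain S \<kappa>' where S: "open S" "e1 \<in> S" "S \<subseteq> \<phi> ` U" "\<And>z. z \<in> S \<Longrightarrow> inv g \<otimes> param z \<otimes> g \<in> U"
    and \<kappa>: "((\<lambda>z. \<phi> (inv g \<otimes> param z \<otimes> g)) has_derivative \<kappa>') (at e1)"
    using chart_expression[OF sm one_U] one_U by auto
  have conj_one: "inv g \<otimes> param e1 \<otimes> g = \<one>" by (simp add: param_e1)
  have "((\<lambda>z. orbit_map y (\<phi> (inv g \<otimes> param z \<otimes> g))) has_derivative (\<lambda>w. T y (\<kappa>' w))) (at e1)"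
    using T_has_derivative[of y] by (intro has_derivative_compose[OF \<kappa>]) (simp add: conj_one)
  moreover have "(act g has_derivative frechet_derivative (act g) (at y))
      (at (orbit_map y (\<phi> (inv g \<otimes> param e1 \<otimes> g))))"
    using smooth_on_has_derivative[OF act_smooth, of y g] by (simp add: conj_one param_e1)
  ultimately have "((\<lambda>z. act g (orbit_map y (\<phi> (inv g \<otimes> param z \<otimes> g)))) has_derivative
      (\<lambda>w. frechet_derivative (act g) (at y) (T y (\<kappa>' w)))) (at e1)"
    by (rule has_derivative_compose)
  then have "(orbit_map (act g y) has_derivative
      (\<lambda>w. frechet_derivative (act g) (at y) (T y (\<kappa>' w)))) (at e1)"
  proof (rule has_derivative_transform_within_open[OF _ S(1,2)])
    fix x assume x: "x \<in> S"
    have "act g (orbit_map y (\<phi> (inv g \<otimes> param x \<otimes> g))) = act (g \<otimes> (inv g \<otimes> param x \<otimes> g)) y"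
      using S(4)[OF x] by (simp add: act_mult)
    also have "g \<otimes> (inv g \<otimes> param x \<otimes> g) = param x \<otimes> g"
      by (simp add: m_assoc[symmetric])
    finally show "act g (orbit_map y (\<phi> (inv g \<otimes> param x \<otimes> g))) = orbit_map (act g y) x"
      by (simp add: act_mult)
  qed
  then have "T (act g y) = (\<lambda>w. frechet_derivative (act g) (at y) (T y (\<kappa>' w)))"
    unfolding T_def by (rule frechet_derivative_at[symmetric])
  then show ?thesis
    by (auto simp: D_def)
qed

definition rank :: "'v \<Rightarrow> nat" where
  "rank y = dim (j ` D y)"

lemma rank_act: "rank (act g y) = rank y"
proof -
  have *: "rank (act g y) \<le> rank y" for g y
  proof -
    have "rank (act g y) \<le> dim (j ` frechet_derivative (act g) (at y) ` D y)"
      unfolding rank_def by (intro dim_subset image_mono D_equivariant)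
    also have "\<dots> \<le> rank y"
      unfolding rank_def
      by (intro dim_j_linear_image_le linear_frechet_derivative smooth_on_differentiable[OF act_smooth]) simp
    finally show ?thesis .
  qed
  have "act (inv g) (act g y) = y"
    by (simp flip: act_mult)
  then show ?thesis
    using *[of g y] *[of "inv g" "act g y"] by simp
qed

section \<open>Flow boxes\<close>

text \<open>A section of \<open>T p\<close> over \<open>D p\<close>, yet linear on the whole space,
  so that \<open>T p \<circ> lift p\<close> is a projection onto \<open>D p\<close>: the \<pi> of
  the overview.\<close>

definition lift :: "'v \<Rightarrow> 'v \<Rightarrow> 'e" where
  "lift p = (SOME s. linear s \<and> (\<forall>v\<in>D p. T p (s v) = v))"

lemma lift: "linear (lift p)" "v \<in> D p \<Longrightarrow> T p (lift p v) = v"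
proof -
  have "\<exists>s. linear s \<and> (\<forall>v\<in>D p. T p (s v) = v)"
    using linear_exists_right_inverse_on[OF linear_T[of p] subspace_UNIV] by (auto simp: D_def)
  from someI_ex[OF this] show "linear (lift p)" "v \<in> D p \<Longrightarrow> T p (lift p v) = v"
    unfolding lift_def by auto
qed

lemma bounded_linear_lift: "bounded_linear (lift p)"
  by (rule bounded_linear_of_linear[OF lift(1)])

lemma bounded_linear_proj: "bounded_linear (\<lambda>z. T p (lift p z))"
  using linear_compose[OF lift(1) linear_T] by (intro bounded_linear_of_linear) (simp add: o_def)

lemma proj_in_D: "T p w \<in> D p"
  by (simp add: D_def)

text \<open>
  In these coordinates around \<open>p\<close> the slices parallel to \<open>D p\<close> are tangent to the distribution,
  so wherever the rank is the one at \<open>p\<close> the distribution is the constant one \<open>D p\<close>.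
\<close>

definition flow_box :: "'v \<Rightarrow> 'v \<Rightarrow> 'v" where
  "flow_box p z = \<Psi> (e1 + lift p z, p + (z - T p (lift p z)))"

definition flow_box_domain :: "'v \<Rightarrow> 'v set" where
  "flow_box_domain p = {z. e1 + lift p z \<in> \<phi> ` U}"

lemma flow_box_smooth: "open (flow_box_domain p)" "smooth_on (flow_box_domain p) (flow_box p)"
proof -
  let ?L = "\<lambda>z. (lift p z, z - T p (lift p z))"
  have bl: "bounded_linear ?L"
    by (intro bounded_linear_Pair bounded_linear_lift bounded_linear_sub bounded_linear_ident bounded_linear_proj)
  have "smooth_on {z. ?L z + (e1, p) \<in> \<phi> ` U \<times> UNIV} (\<lambda>z. \<Psi> (?L z + (e1, p)))"
    by (rule smooth_on_affine_precomp[OF open_domain bl \<Psi>_smooth])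
  then show "smooth_on (flow_box_domain p) (flow_box p)"
    by (simp add: flow_box_domain_def flow_box_def[abs_def] add.commute)
  have "continuous_on UNIV (\<lambda>z. e1 + lift p z)"
    by (intro continuous_on_add continuous_on_const linear_continuous_on bounded_linear_lift)
  from open_vimage[OF chartD(2) this] show "open (flow_box_domain p)"
    by (simp add: flow_box_domain_def vimage_def)
qed

lemma flow_box_eq: "u \<in> D p \<Longrightarrow> flow_box p u = orbit_map p (e1 + lift p u)"
  by (simp add: flow_box_def lift(2))

lemma zero_in_flow_box_domain: "0 \<in> flow_box_domain p"
  using e1_in linear_0[OF lift(1)] by (simp add: flow_box_domain_def)

lemma flow_box_0 [simp]: "flow_box p 0 = p"
  using linear_0[OF lift(1)] linear_0[OF linear_T] by (simp add: flow_box_def param_e1)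

section \<open>Derivatives of flow boxes\<close>

lemma \<Psi>_has_derivative:
  "z \<in> \<phi> ` U \<Longrightarrow> (\<Psi> has_derivative frechet_derivative \<Psi> (at (z, y))) (at (z, y))"
  by (rule smooth_on_has_derivative[OF \<Psi>_smooth]) simp

lemma \<Psi>_partial1:
  assumes "z \<in> \<phi> ` U"
  shows "frechet_derivative \<Psi> (at (z, y)) (a, 0) = frechet_derivative (orbit_map y) (at z) a"
proof -
  have "((\<lambda>x. (x, y)) has_derivative (\<lambda>a. (a, 0))) (at z)"
    by (auto intro!: derivative_eq_intros)
  from has_derivative_compose[OF this \<Psi>_has_derivative[OF assms]]
  have "(orbit_map y has_derivative (\<lambda>a. frechet_derivative \<Psi> (at (z, y)) (a, 0))) (at z)" by simp
  from frechet_derivative_at[OF this] show ?thesis by (rule fun_cong)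
qed

lemma \<Psi>_partial2: "frechet_derivative \<Psi> (at (e1, y)) (0, b) = b"
proof -
  have "((\<lambda>x. (e1, x)) has_derivative (\<lambda>a. (0, a))) (at y)"
    by (auto intro!: derivative_eq_intros)
  from has_derivative_compose[OF this \<Psi>_has_derivative[OF e1_in]]
  have "((\<lambda>x. x) has_derivative (\<lambda>a. frechet_derivative \<Psi> (at (e1, y)) (0, a))) (at y)"
    by (simp add: param_e1)
  from frechet_derivative_at[OF this] show ?thesis
    by (simp add: fun_eq_iff)
qed

lemma flow_box_has_derivative:
  assumes "z \<in> flow_box_domain p"
  shows "(flow_box p has_derivative (\<lambda>v. frechet_derivative \<Psi> (at (e1 + lift p z, p + (z - T p (lift p z))))
    (lift p v, v - T p (lift p v)))) (at z)"
proof -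
  have "((\<lambda>z. (e1 + lift p z, p + (z - T p (lift p z)))) has_derivative
      (\<lambda>v. (0 + lift p v, 0 + (v - T p (lift p v))))) (at z)"
    by (intro has_derivative_Pair has_derivative_add has_derivative_diff has_derivative_const
        has_derivative_ident bounded_linear_imp_has_derivative bounded_linear_lift bounded_linear_proj)
  from has_derivative_compose[OF this \<Psi>_has_derivative] assms
  show ?thesis
    by (simp add: flow_box_def[abs_def] flow_box_domain_def)
qed

text \<open>For \<open>v\<close> in \<open>D p\<close> the transverse part
  \<open>v - T p (lift p v)\<close> is 0, so only the group variable moves and the derivative is
  that of an orbit map.\<close>

lemma flow_box_derivative_tangent:
  assumes "z \<in> flow_box_domain p" "v \<in> D p"
  shows "frechet_derivative (flow_box p) (at z) v \<in> D (flow_box p z)"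
proof -
  have z: "e1 + lift p z \<in> \<phi> ` U" using assms(1) by (simp add: flow_box_domain_def)
  have "frechet_derivative (flow_box p) (at z) v =
      frechet_derivative \<Psi> (at (e1 + lift p z, p + (z - T p (lift p z)))) (lift p v, 0)"
    using assms(2) by (simp add: lift(2) frechet_derivative_at[OF flow_box_has_derivative[OF assms(1)], symmetric])
  also have "\<dots> \<in> D (flow_box p z)"
    using orbit_map_derivative_range[OF z] by (simp add: \<Psi>_partial1[OF z] flow_box_def)
  finally show ?thesis .
qed

text \<open>The group variable contributes \<open>T p (lift p v)\<close> and the transverse variable
  the remainder of \<open>v\<close>.\<close>

lemma flow_box_derivative_0: "frechet_derivative (flow_box p) (at 0) v = v"
proof -
  note l0 = linear_0[OF lift(1)] linear_0[OF linear_T]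
  interpret l: linear "frechet_derivative \<Psi> (at (e1, p))"
    by (rule has_derivative_linear[OF \<Psi>_has_derivative[OF e1_in]])
  have "frechet_derivative (flow_box p) (at 0) v =
      frechet_derivative \<Psi> (at (e1, p)) ((lift p v, 0) + (0, v - T p (lift p v)))"
    by (simp add: frechet_derivative_at[OF flow_box_has_derivative[OF zero_in_flow_box_domain], symmetric] l0)
  also have "\<dots> = v"
    unfolding l.add \<Psi>_partial2 \<Psi>_partial1[OF e1_in] by (simp add: T_def)
  finally show ?thesis .
qed

text \<open>\<open>Q\<close> is the straightening inverse. Of its derivative only the left inverse
  law is recorded: it makes the derivative of \<open>flow_box p\<close> injective and carries
  tangent vectors of the slices back to \<open>D p\<close>.\<close>

definition flat_chart :: "'v \<Rightarrow> 'v set \<Rightarrow> 'v set \<Rightarrow> ('v \<Rightarrow> 'v) \<Rightarrow> bool" where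
  "flat_chart p Z N Q \<longleftrightarrow> open Z \<and> 0 \<in> Z \<and> Z \<subseteq> flow_box_domain p \<and> open N \<and> homeomorphism Z N (flow_box p) Q \<and>
     (\<forall>y\<in>N. \<exists>Q'. (Q has_derivative Q') (at y) \<and>
        (\<forall>v. Q' (frechet_derivative (flow_box p) (at (Q y)) v) = v))"

lemma ex_flat_chart: obtains Z N Q where "flat_chart p Z N Q"
proof -
  have d: "(flow_box p has_derivative frechet_derivative (flow_box p) (at z)) (at z)" if "z \<in> flow_box_domain p" for z
    using smooth_on_has_derivative[OF flow_box_smooth(2) that] .
  have c: "continuous_on (flow_box_domain p) (\<lambda>z. frechet_derivative (flow_box p) (at z) v)" for v
    by (intro smooth_on_continuous_on smooth_on_directional_derivative flow_box_smooth)
  show thesis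
  proof (rule inverse_function[OF flow_box_smooth(1) zero_in_flow_box_domain d c flow_box_derivative_0])
    fix Z N Q Q'
    assume "open Z" "0 \<in> Z" "Z \<subseteq> flow_box_domain p" "open N" "homeomorphism Z N (flow_box p) Q"
      and "\<And>y. y \<in> N \<Longrightarrow> (Q has_derivative Q' y) (at y)"
      and "\<And>y v. y \<in> N \<Longrightarrow> Q' y (frechet_derivative (flow_box p) (at (Q y)) v) = v"
    then have "flat_chart p Z N Q"
      unfolding flat_chart_def by (intro conjI ballI exI[of _ "Q' y" for y] allI) simp_all
    then show thesis by (rule that)
  qed
qed

lemma flat_chartD:
  assumes "flat_chart p Z N Q"
  shows "open Z" "0 \<in> Z" "Z \<subseteq> flow_box_domain p" "open N"
    "\<And>z. z \<in> Z \<Longrightarrow> flow_box p z \<in> N" "\<And>z. z \<in> Z \<Longrightarrow> Q (flow_box p z) = z"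
    "\<And>y. y \<in> N \<Longrightarrow> Q y \<in> Z" "\<And>y. y \<in> N \<Longrightarrow> flow_box p (Q y) = y"
    "continuous_on N Q" "continuous_on Z (flow_box p)"
    "p \<in> N" "Q p = 0"
proof -
  have h: "homeomorphism Z N (flow_box p) Q" and z: "0 \<in> Z"
    using assms by (simp_all add: flat_chart_def)
  show "open Z" "0 \<in> Z" "Z \<subseteq> flow_box_domain p" "open N"
    using assms by (simp_all add: flat_chart_def)
  show *: "\<And>z. z \<in> Z \<Longrightarrow> flow_box p z \<in> N" "\<And>z. z \<in> Z \<Longrightarrow> Q (flow_box p z) = z"
    "\<And>y. y \<in> N \<Longrightarrow> Q y \<in> Z" "\<And>y. y \<in> N \<Longrightarrow> flow_box p (Q y) = y"
    "continuous_on N Q" "continuous_on Z (flow_box p)"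
    using h by (auto simp: homeomorphism_def)
  show "p \<in> N" "Q p = 0"
    using *(1,2)[OF z] by simp_all
qed

lemma linear_flow_box_derivative:
  assumes "z \<in> flow_box_domain p"
  shows "linear (frechet_derivative (flow_box p) (at z))"
  by (rule linear_frechet_derivative[OF smooth_on_differentiable[OF flow_box_smooth(2) assms]])

lemma flat_chart_derivative_inj:
  assumes "flat_chart p Z N Q" "z \<in> Z"
  shows "inj (frechet_derivative (flow_box p) (at z))"
proof -
  note f = flat_chartD[OF assms(1)]
  have "\<forall>y\<in>N. \<exists>Q'. (Q has_derivative Q') (at y) \<and>
      (\<forall>v. Q' (frechet_derivative (flow_box p) (at (Q y)) v) = v)"
    using assms(1) by (simp add: flat_chart_def)
  from bspec[OF this f(5)[OF assms(2)]] obtain Q'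
    where "\<forall>v. Q' (frechet_derivative (flow_box p) (at z) v) = v"
    using f(6)[OF assms(2)] by auto
  then show ?thesis by (metis injI)
qed

text \<open>The image of \<open>D p\<close> is contained in the distribution and, the derivative
  being injective, has dimension \<open>rank p\<close>; the bound on the rank leaves no room for
  more.\<close>

lemma flat_chart_D:
  assumes fc: "flat_chart p Z N Q" and z: "z \<in> Z" and rank: "rank (flow_box p z) \<le> rank p"
  shows "frechet_derivative (flow_box p) (at z) ` D p = D (flow_box p z)"
proof -
  let ?L = "frechet_derivative (flow_box p) (at z)"
  have zd: "z \<in> flow_box_domain p" using flat_chartD(3)[OF fc] z by blast
  note lin = linear_flow_box_derivative[OF zd]
  note inj = inj_on_subset[OF flat_chart_derivative_inj[OF fc z] subset_UNIV]
  show ?thesis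
  proof (rule subspace_eq_of_dim)
    show "subspace (?L ` D p)" by (rule linear_subspace_image[OF lin subspace_D])
    show "?L ` D p \<subseteq> D (flow_box p z)" using flow_box_derivative_tangent[OF zd] by auto
    show "dim (j ` D (flow_box p z)) \<le> dim (j ` ?L ` D p)"
      using rank dim_j_linear_image_eq[OF lin inj subspace_D] by (simp add: rank_def)
  qed (rule subspace_D)
qed

text \<open>Along the segment from \<open>u0\<close> to \<open>u\<close> the velocity of
  \<open>\<psi>\<close> lies in the image of \<open>D p\<close>, so \<open>Q\<close> straightens it
  to a vector of \<open>D p\<close>. The component of \<open>Q\<close> after \<open>\<psi>\<close>
  transverse to \<open>D p\<close> thus has derivative 0 and keeps its initial value 0.
  \<open>S\<close> is the whole model space when \<open>\<psi>\<close> is an orbit map, and the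
  parameter space when \<open>\<psi>\<close> parametrizes an integral manifold.\<close>

lemma flat_chart_slice:
  fixes \<psi> :: "'a::real_normed_vector \<Rightarrow> 'v"
  assumes fc: "flat_chart p Z N Q" and S: "subspace S" and B: "convex B" and u: "u0 \<in> B \<inter> S" "u \<in> B \<inter> S"
    and d: "\<And>u. u \<in> B \<inter> S \<Longrightarrow> (\<psi> has_derivative \<psi>' u) (at u)"
    and tan: "\<And>u v. u \<in> B \<inter> S \<Longrightarrow> v \<in> S \<Longrightarrow> \<psi>' u v \<in> D (\<psi> u)"
    and N: "\<And>u. u \<in> B \<inter> S \<Longrightarrow> \<psi> u \<in> N"
    and rank: "\<And>u. u \<in> B \<inter> S \<Longrightarrow> rank (\<psi> u) \<le> rank p"
    and start: "Q (\<psi> u0) \<in> D p"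
  shows "Q (\<psi> u) \<in> D p"
proof -
  note f = flat_chartD[OF fc]
  define c where "c t = u0 + t *\<^sub>R (u - u0)" for t
  have c: "c t \<in> B \<inter> S" if "t \<in> {0..1}" for t
  proof
    have "c t = (1 - t) *\<^sub>R u0 + t *\<^sub>R u" by (simp add: c_def algebra_simps)
    then show "c t \<in> B" using that u B by (simp add: convexD)
    show "c t \<in> S" unfolding c_def using u S
      by (intro subspace_add subspace_scale subspace_diff) auto
  qed
  have uS: "u - u0 \<in> S" using u S by (intro subspace_diff) auto
  \<comment> \<open>The transverse coordinate; it vanishes exactly on \<open>D p\<close>.\<close>
  let ?n = "\<lambda>q. q - T p (lift p q)"
  have n_lin: "bounded_linear ?n"
    by (intro bounded_linear_sub bounded_linear_ident bounded_linear_proj)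
  have "((\<lambda>t. ?n (Q (\<psi> (c t)))) has_derivative (\<lambda>h. 0)) (at t within {0..1})" if t: "t \<in> {0..1}" for t
  proof -
    have N': "\<psi> (c t) \<in> N" using N c t by blast
    then obtain Q' where Q': "(Q has_derivative Q') (at (\<psi> (c t)))"
      "\<And>v. Q' (frechet_derivative (flow_box p) (at (Q (\<psi> (c t)))) v) = v"
      using fc unfolding flat_chart_def by meson
    interpret Q': linear Q' by (rule has_derivative_linear[OF Q'(1)])
    interpret \<psi>': linear "\<psi>' (c t)" by (rule has_derivative_linear[OF d[OF c[OF t]]])
    interpret n: linear ?n by (rule bounded_linear.linear[OF n_lin])
    have dc: "(c has_derivative (\<lambda>h. h *\<^sub>R (u - u0))) (at t)"
      unfolding c_def[abs_def] by (auto intro!: derivative_eq_intros)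
    have 1: "((\<lambda>t. ?n (Q (\<psi> (c t)))) has_derivative (\<lambda>h. ?n (Q' (\<psi>' (c t) (h *\<^sub>R (u - u0)))))) (at t)"
      by (rule bounded_linear.has_derivative[OF n_lin has_derivative_compose[OF has_derivative_compose[OF dc d[OF c[OF t]]] Q'(1)]])
    have "\<psi>' (c t) (u - u0) \<in> D (flow_box p (Q (\<psi> (c t))))"
      using tan[OF c[OF t] uS] by (simp add: f(8)[OF N'])
    also have "D (flow_box p (Q (\<psi> (c t)))) = frechet_derivative (flow_box p) (at (Q (\<psi> (c t)))) ` D p"
      using rank[OF c[OF t]] by (intro flat_chart_D[OF fc f(7)[OF N'], symmetric]) (simp add: f(8)[OF N'])
    finally obtain w where w: "w \<in> D p" "\<psi>' (c t) (u - u0) = frechet_derivative (flow_box p) (at (Q (\<psi> (c t)))) w"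
      by (rule imageE)
    have "?n (Q' (\<psi>' (c t) (h *\<^sub>R (u - u0)))) = 0" for h
    proof -
      have "?n (Q' (\<psi>' (c t) (h *\<^sub>R (u - u0)))) = h *\<^sub>R ?n w"
        by (simp only: \<psi>'.scale w(2) Q'.scale Q'(2) n.scale)
      then show ?thesis using w(1) by (simp add: lift(2))
    qed
    then show ?thesis
      using has_derivative_at_withinI[OF 1] by simp
  qed
  then have "?n (Q (\<psi> (c 1))) = ?n (Q (\<psi> (c 0)))"
    by (rule has_derivative_zero_unique[OF convex_real_interval(5)]) auto
  then have "?n (Q (\<psi> u)) = ?n (Q (\<psi> u0))"
    by (simp add: c_def)
  then have "Q (\<psi> u) = T p (lift p (Q (\<psi> u)))"
    using start by (simp add: lift(2))
  then show ?thesis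
    using proj_in_D by metis
qed

section \<open>The orbit topology\<close>

lemma orbit_eq: "orbit G act x = range (\<lambda>g. act g x)"
  by (auto simp: orbit_def)

lemma orbit_self: "x \<in> orbit G act x"
  unfolding orbit_eq using act_one by (metis rangeI)

lemma act_in_orbit: "y \<in> orbit G act x \<Longrightarrow> act g y \<in> orbit G act x"
  unfolding orbit_eq by (auto simp flip: act_mult)

lemma orbit_cong: "y \<in> orbit G act x \<Longrightarrow> orbit G act y = orbit G act x"
proof -
  assume "y \<in> orbit G act x"
  then obtain g where g: "y = act g x" by (auto simp: orbit_eq)
  then have x: "x = act (inv g) y" by (simp flip: act_mult)
  show ?thesis
  proof
    show "orbit G act y \<subseteq> orbit G act x"
      by (auto simp: orbit_eq g simp flip: act_mult)
    show "orbit G act x \<subseteq> orbit G act y"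
      by (subst x) (auto simp: orbit_eq simp flip: act_mult)
  qed
qed

lemma rank_orbit: "y \<in> orbit G act x \<Longrightarrow> rank y = rank x"
  by (auto simp: orbit_eq rank_act)

text \<open>An orbit need not be embedded, so its topology comes from the group and not from
  \<open>'v\<close>.\<close>

definition orbit_topology :: "'v \<Rightarrow> 'v topology" where
  "orbit_topology x = topology (\<lambda>W. W \<subseteq> orbit G act x \<and> open ((\<lambda>g. act g x) -` W))"

lemma openin_orbit_topology:
  "openin (orbit_topology x) W \<longleftrightarrow> W \<subseteq> orbit G act x \<and> open ((\<lambda>g. act g x) -` W)"
proof -
  have "istopology (\<lambda>W. W \<subseteq> orbit G act x \<and> open ((\<lambda>g. act g x) -` W))"
    unfolding istopology_def
    by (auto simp: vimage_Union)
  then show ?thesis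
    by (simp add: orbit_topology_def topology_inverse')
qed

lemma topspace_orbit_topology [simp]: "topspace (orbit_topology x) = orbit G act x"
proof -
  have "(\<lambda>g. act g x) -` orbit G act x = UNIV"
    by (auto simp: orbit_eq)
  then have "openin (orbit_topology x) (orbit G act x)"
    by (simp add: openin_orbit_topology)
  then have "orbit G act x \<subseteq> topspace (orbit_topology x)"
    by (rule openin_subset)
  moreover have "topspace (orbit_topology x) \<subseteq> orbit G act x"
    using openin_topspace[of "orbit_topology x"] by (simp only: openin_orbit_topology)
  ultimately show ?thesis by (rule equalityI[rotated])
qed

lemma connected_orbit_topology:
  assumes "connected (UNIV :: 'g set)"
  shows "connected_space (orbit_topology x)"
proof -
  have "continuous_map euclidean (orbit_topology x) (\<lambda>g. act g x)"
    by (auto simp: continuous_map_def openin_orbit_topology orbit_eq vimage_def)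
  moreover have "connectedin euclidean (UNIV :: 'g set)"
    using assms by simp
  ultimately have "connectedin (orbit_topology x) (range (\<lambda>g. act g x))"
    by (rule connectedin_continuous_map_image)
  then show ?thesis
    by (metis connectedin_topspace orbit_eq topspace_orbit_topology)
qed

section \<open>Plaques: images under \<open>flow_box p\<close> of relatively open pieces of
  \<open>D p\<close>\<close>

lemma flow_box_in_orbit:
  assumes "u \<in> D p"
  shows "flow_box p u \<in> orbit G act p"
  using assms by (simp add: flow_box_eq act_in_orbit orbit_self)

lemma continuous_translate: "continuous_on UNIV (\<lambda>g. g \<otimes> h)"
  by (rule smooth_map_continuous[OF lie_group_smooth(2)[OF lie]])

text \<open>If \<open>g0\<close> sends \<open>x\<close> to a point \<open>y\<close> of the plaque,
  the orbit map of \<open>y\<close> near the unit stays in the same slice by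
  \<open>flat_chart_slice\<close>, the rank being constant on the orbit. Elements near
  \<open>g0\<close> are products of elements near the unit with \<open>g0\<close>, so they send
  \<open>x\<close> into the plaque as well.\<close>

lemma flat_chart_plaque_open:
  assumes fc: "flat_chart p Z N Q" and p: "p \<in> orbit G act x" and V: "open V" "V \<subseteq> Z"
  shows "openin (orbit_topology x) (flow_box p ` (V \<inter> D p))"
  unfolding openin_orbit_topology
proof
  note f = flat_chartD[OF fc]
  show "flow_box p ` (V \<inter> D p) \<subseteq> orbit G act x"
    using flow_box_in_orbit orbit_cong[OF p] by auto
  show "open ((\<lambda>g. act g x) -` flow_box p ` (V \<inter> D p))"
  proof (subst open_subopen, intro ballI)
    fix g0 assume "g0 \<in> (\<lambda>g. act g x) -` flow_box p ` (V \<inter> D p)"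
    then obtain u0 where u0: "u0 \<in> V" "u0 \<in> D p" "act g0 x = flow_box p u0" by auto
    define y where "y = act g0 x"
    have y: "y \<in> orbit G act x" by (simp add: y_def orbit_eq)
    have "open (Q -` V \<inter> N)"
      using f(4,9) V(1) by (simp add: continuous_on_open_vimage)
    then have "open (orbit_map y -` (Q -` V \<inter> N) \<inter> \<phi> ` U)"
      by (rule continuous_on_open_vimage[OF chartD(2), THEN iffD1, rule_format,
            OF smooth_on_continuous_on[OF orbit_map_smooth]])
    moreover have "e1 \<in> orbit_map y -` (Q -` V \<inter> N) \<inter> \<phi> ` U"
      using u0 V f(5,6) e1_in by (auto simp: param_e1 y_def)
    ultimately obtain \<epsilon> where \<epsilon>: "\<epsilon> > 0" "ball e1 \<epsilon> \<subseteq> orbit_map y -` (Q -` V \<inter> N) \<inter> \<phi> ` U"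
      by (rule openE)
    let ?B = "ball e1 \<epsilon>"
    have plaque: "orbit_map y z \<in> flow_box p ` (V \<inter> D p)" if z: "z \<in> ?B" for z
    proof -
      have "Q (orbit_map y z) \<in> D p"
      proof (rule flat_chart_slice[OF fc subspace_UNIV convex_ball, where ?u0.0 = e1 and u = z and \<psi> = "orbit_map y"
            and \<psi>' = "\<lambda>z. frechet_derivative (orbit_map y) (at z)"])
        show "e1 \<in> ?B \<inter> UNIV" "z \<in> ?B \<inter> UNIV" using \<epsilon>(1) z by auto
        show "(orbit_map y has_derivative frechet_derivative (orbit_map y) (at z)) (at z)"
          if "z \<in> ?B \<inter> UNIV" for z
          using that \<epsilon>(2) by (intro orbit_map_has_derivative) auto
        show "frechet_derivative (orbit_map y) (at z) v \<in> D (orbit_map y z)"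
          if "z \<in> ?B \<inter> UNIV" for z v
          using that \<epsilon>(2) by (intro orbit_map_derivative_range) auto
        show "orbit_map y z \<in> N" if "z \<in> ?B \<inter> UNIV" for z
          using that \<epsilon>(2) by auto
        show "rank (orbit_map y z) \<le> rank p" if "z \<in> ?B \<inter> UNIV" for z
          using rank_orbit[OF p] rank_orbit[OF y] by (simp add: rank_act)
        show "Q (orbit_map y e1) \<in> D p"
          using u0 V(2) f(6)[of u0] by (auto simp: param_e1 y_def)
      qed
      moreover have "orbit_map y z \<in> N" "Q (orbit_map y z) \<in> V"
        using z \<epsilon>(2) by auto
      ultimately show ?thesis
        using f(8) by (intro image_eqI[of _ _ "Q (orbit_map y z)"]) auto
    qed
    let ?O = "(\<lambda>g. g \<otimes> inv g0) -` (\<phi> -` ?B \<inter> U)"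
    have "open (\<phi> -` ?B \<inter> U)"
      using chartD(1,4) by (simp add: continuous_on_open_vimage)
    then have "open ?O"
      using continuous_translate by (rule open_vimage)
    moreover have "g0 \<in> ?O" using \<epsilon>(1) one_U by simp
    moreover have "?O \<subseteq> (\<lambda>g. act g x) -` flow_box p ` (V \<inter> D p)"
    proof
      fix g assume g: "g \<in> ?O"
      have "orbit_map y (\<phi> (g \<otimes> inv g0)) = act (g \<otimes> inv g0 \<otimes> g0) x"
        using g by (simp add: y_def act_mult)
      also have "g \<otimes> inv g0 \<otimes> g0 = g" by (simp add: m_assoc)
      finally have "orbit_map y (\<phi> (g \<otimes> inv g0)) = act g x" .
      then show "g \<in> (\<lambda>g. act g x) -` flow_box p ` (V \<inter> D p)"
        using plaque[of "\<phi> (g \<otimes> inv g0)"] g by simp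
    qed
    ultimately show "\<exists>T. open T \<and> g0 \<in> T \<and> T \<subseteq> (\<lambda>g. act g x) -` flow_box p ` (V \<inter> D p)"
      by (intro exI[of _ ?O] conjI)
  qed
qed

text \<open>On \<open>D p\<close> the flow box lifts to the continuous map
  \<open>u \<mapsto> param (e1 + lift p u) \<otimes> h\<close> into the group, where
  \<open>p = act h x\<close>; preimages of sets open in the orbit are therefore open.\<close>

lemma flow_box_orbit_continuous:
  assumes p: "p \<in> orbit G act x" and W: "openin (orbit_topology x) W"
  obtains V where "open V" "\<And>u. u \<in> D p \<Longrightarrow> u \<in> flow_box_domain p \<Longrightarrow> flow_box p u \<in> W \<longleftrightarrow> u \<in> V"
proof -
  obtain h where h: "p = act h x" using p by (auto simp: orbit_eq)
  let ?M = "(\<lambda>g. act g x) -` W"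
  have M: "open ?M" using W by (simp add: openin_orbit_topology)
  have "continuous_on UNIV (\<lambda>z. e1 + lift p z)"
    by (intro continuous_on_add continuous_on_const linear_continuous_on bounded_linear_lift)
  then have "continuous_on (flow_box_domain p) (\<lambda>z. param (e1 + lift p z) \<otimes> h)"
    by (intro continuous_on_compose2[OF continuous_translate] continuous_on_compose2[OF chartD(5)])
       (auto simp: flow_box_domain_def intro: continuous_on_subset)
  then have "open ((\<lambda>z. param (e1 + lift p z) \<otimes> h) -` ?M \<inter> flow_box_domain p)"
    using M flow_box_smooth(1) by (simp add: continuous_on_open_vimage)
  then show ?thesis
    by (rule that) (simp add: flow_box_eq h act_mult)
qed

text \<open>Around \<open>p\<close> the parametrization is the flow box on
  \<open>Z \<inter> D p\<close>: open by \<open>flat_chart_plaque_open\<close>, continuous by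
  \<open>flow_box_orbit_continuous\<close>, and tangent by \<open>flat_chart_D\<close>, since all
  ranks on the orbit agree.\<close>

lemma integral_manifold_orbit_topology: "integral_manifold D (orbit_topology x)"
  unfolding integral_manifold_def topspace_orbit_topology
proof
  fix p assume p: "p \<in> orbit G act x"
  obtain Z N Q where fc: "flat_chart p Z N Q" by (rule ex_flat_chart)
  note f = flat_chartD[OF fc]
  let ?P = "flow_box p ` (Z \<inter> D p)"
  have P: "openin (orbit_topology x) ?P"
    by (rule flat_chart_plaque_open[OF fc p f(1) subset_refl])
  then have Px: "?P \<subseteq> orbit G act x" by (simp add: openin_orbit_topology)
  have inj: "inj_on (flow_box p) (Z \<inter> D p)"
    by (rule inj_on_inverseI[of _ Q]) (simp add: f(6))
  have "homeomorphic_map (top_of_set (Z \<inter> D p)) (subtopology (orbit_topology x) ?P) (flow_box p)"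
  proof (rule bijective_open_imp_homeomorphic_map)
    show "flow_box p ` topspace (top_of_set (Z \<inter> D p)) = topspace (subtopology (orbit_topology x) ?P)"
      using Px by auto
    show "inj_on (flow_box p) (topspace (top_of_set (Z \<inter> D p)))"
      using inj by simp
    show "continuous_map (top_of_set (Z \<inter> D p)) (subtopology (orbit_topology x) ?P) (flow_box p)"
    proof (rule continuous_map_into_subtopology)
      show "continuous_map (top_of_set (Z \<inter> D p)) (orbit_topology x) (flow_box p)"
        unfolding continuous_map_def
      proof (intro conjI allI impI)
        show "flow_box p \<in> topspace (top_of_set (Z \<inter> D p)) \<rightarrow> topspace (orbit_topology x)"
          using Px by auto
        fix W assume "openin (orbit_topology x) W"
        then obtain V where V: "open V"
          "\<And>u. u \<in> D p \<Longrightarrow> u \<in> flow_box_domain p \<Longrightarrow> flow_box p u \<in> W \<longleftrightarrow> u \<in> V"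
          using flow_box_orbit_continuous[OF p] by metis
        have "{u \<in> topspace (top_of_set (Z \<inter> D p)). flow_box p u \<in> W} = (Z \<inter> D p) \<inter> V"
          using V(2) f(3) by auto
        then show "openin (top_of_set (Z \<inter> D p)) {u \<in> topspace (top_of_set (Z \<inter> D p)). flow_box p u \<in> W}"
          using V(1) by (simp add: openin_open_Int)
      qed
    qed auto
    show "open_map (top_of_set (Z \<inter> D p)) (subtopology (orbit_topology x) ?P) (flow_box p)"
      unfolding open_map_def
    proof (intro allI impI)
      fix W assume "openin (top_of_set (Z \<inter> D p)) W"
      then obtain V where V: "open V" "W = (Z \<inter> D p) \<inter> V" by (auto simp: openin_open)
      have "openin (orbit_topology x) (flow_box p ` ((Z \<inter> V) \<inter> D p))"
        by (rule flat_chart_plaque_open[OF fc p]) (use f(1) V in auto)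
      moreover have "(Z \<inter> V) \<inter> D p = W" using V by auto
      ultimately show "openin (subtopology (orbit_topology x) ?P) (flow_box p ` W)"
        using V(2) by (auto simp: openin_open_subtopology[OF P])
    qed
  qed
  moreover have "inj_on (frechet_derivative (flow_box p) (at u)) (D p)"
    "frechet_derivative (flow_box p) (at u) ` D p = D (flow_box p u)" if "u \<in> Z \<inter> D p" for u
  proof -
    show "inj_on (frechet_derivative (flow_box p) (at u)) (D p)"
      using flat_chart_derivative_inj[OF fc] that by (auto intro: inj_on_subset)
    show "frechet_derivative (flow_box p) (at u) ` D p = D (flow_box p u)"
      using that by (intro flat_chart_D[OF fc]) (auto simp: flow_box_eq rank_act)
  qed
  moreover have "p \<in> ?P"
    using f(2) subspace_0[OF subspace_D] by (intro image_eqI[of _ _ 0]) auto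
  ultimately show "\<exists>S U (\<phi> :: 'v \<Rightarrow> 'v). subspace S \<and> open U \<and> smooth_on U \<phi> \<and>
        p \<in> \<phi> ` (U \<inter> S) \<and> openin (orbit_topology x) (\<phi> ` (U \<inter> S)) \<and>
        homeomorphic_map (top_of_set (U \<inter> S)) (subtopology (orbit_topology x) (\<phi> ` (U \<inter> S))) \<phi> \<and>
        (\<forall>u\<in>U \<inter> S. inj_on (frechet_derivative \<phi> (at u)) S \<and> frechet_derivative \<phi> (at u) ` S = D (\<phi> u))"
    using P f(1) smooth_on_subset[OF flow_box_smooth(2) f(3)] subspace_D
    by (intro exI[of _ "D p"] exI[of _ Z] exI[of _ "flow_box p"]) simp
qed

section \<open>Maximality of the orbits\<close>

text \<open>A parametrization \<open>\<psi>\<close> stays in the slice of the flow box through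
  \<open>q\<close>, so \<open>Q\<close> after \<open>\<psi>\<close> is a continuous injection from a
  piece of \<open>S\<close> into \<open>D q\<close>. Both spaces have dimension
  \<open>rank q\<close>, and invariance of domain makes the image open. Small plaques at
  \<open>q\<close> are thus pieces of the manifold, open in its own topology.\<close>

lemma integral_manifold_flat_chart:
  assumes man: "integral_manifold D \<tau>" and W: "openin \<tau> W" "q \<in> W" and fc: "flat_chart q Z N Q"
  obtains V where "open V" "0 \<in> V" "V \<subseteq> Z" "flow_box q ` (V \<inter> D q) \<subseteq> W"
    "\<And>V'. open V' \<Longrightarrow> V' \<subseteq> V \<Longrightarrow> openin \<tau> (flow_box q ` (V' \<inter> D q))"
proof -
  note f = flat_chartD[OF fc]
  have "q \<in> topspace \<tau>" using W openin_subset by blast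
  from bspec[OF man[unfolded integral_manifold_def] this]
  obtain S O1 and \<psi> :: "'v \<Rightarrow> 'v" where *: "subspace S \<and> open O1 \<and> smooth_on O1 \<psi> \<and> q \<in> \<psi> ` (O1 \<inter> S) \<and>
    openin \<tau> (\<psi> ` (O1 \<inter> S)) \<and>
    homeomorphic_map (top_of_set (O1 \<inter> S)) (subtopology \<tau> (\<psi> ` (O1 \<inter> S))) \<psi> \<and>
    (\<forall>u\<in>O1 \<inter> S. inj_on (frechet_derivative \<psi> (at u)) S \<and> frechet_derivative \<psi> (at u) ` S = D (\<psi> u))"
    by (elim exE) (rule that)
  then have S: "subspace S" "open O1" "smooth_on O1 \<psi>" "q \<in> \<psi> ` (O1 \<inter> S)"
    "openin \<tau> (\<psi> ` (O1 \<inter> S))"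
    "homeomorphic_map (top_of_set (O1 \<inter> S)) (subtopology \<tau> (\<psi> ` (O1 \<inter> S))) \<psi>"
    "\<And>u. u \<in> O1 \<inter> S \<Longrightarrow> inj_on (frechet_derivative \<psi> (at u)) S"
    "\<And>u. u \<in> O1 \<inter> S \<Longrightarrow> frechet_derivative \<psi> (at u) ` S = D (\<psi> u)"
    by simp_all
  let ?P = "\<psi> ` (O1 \<inter> S)"
  obtain u0 where u0: "u0 \<in> O1" "u0 \<in> S" "\<psi> u0 = q" using S(4) by auto
  have d: "(\<psi> has_derivative frechet_derivative \<psi> (at u)) (at u)" if "u \<in> O1" for u
    by (rule smooth_on_has_derivative[OF S(3) that])
  \<comment> \<open>The tangent spaces are injective images of \<open>S\<close>, so the rank is
    constant on the parametrized piece; this supplies the rank bound in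
    \<open>flat_chart_slice\<close>.\<close>
  have rank_\<psi>: "rank (\<psi> u) = dim (j ` S)" if "u \<in> O1 \<inter> S" for u
    using dim_j_linear_image_eq[OF has_derivative_linear[OF d] S(7)[OF that] S(1)] that
    by (simp add: rank_def S(8)[OF that])
  have inj: "inj_on \<psi> (O1 \<inter> S)" and cont: "continuous_on O1 \<psi>"
    using S(6) smooth_on_continuous_on[OF S(3)] by (auto simp: homeomorphic_map_def)
  have open_\<psi>: "openin \<tau> (\<psi> ` X)" if "openin (top_of_set (O1 \<inter> S)) X" for X
  proof -
    have "openin (subtopology \<tau> ?P) (\<psi> ` X)"
      using homeomorphic_imp_open_map[OF S(6)] that by (simp add: open_map_def)
    then show ?thesis using openin_open_subtopology[OF S(5)] by blast
  qed
  have "openin (subtopology \<tau> ?P) (W \<inter> ?P)"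
    using W(1) by (simp add: openin_subtopology_Int)
  then have "openin (top_of_set (O1 \<inter> S)) {u \<in> topspace (top_of_set (O1 \<inter> S)). \<psi> u \<in> W \<inter> ?P}"
    using homeomorphic_imp_continuous_map[OF S(6)] openin_continuous_map_preimage by blast
  then obtain O2 where O2: "open O2" "{u \<in> O1 \<inter> S. \<psi> u \<in> W \<inter> ?P} = (O1 \<inter> S) \<inter> O2"
    by (auto simp: openin_open)
  have "open (\<psi> -` N \<inter> O1)"
    using cont S(2) f(4) by (simp add: continuous_on_open_vimage)
  then have "open (O2 \<inter> (\<psi> -` N \<inter> O1))"
    by (rule open_Int[OF O2(1)])
  moreover have "u0 \<in> O2 \<inter> (\<psi> -` N \<inter> O1)"
    using O2(2) u0 W(2) f(11) by auto
  ultimately obtain \<epsilon> where \<epsilon>: "\<epsilon> > 0" "ball u0 \<epsilon> \<subseteq> O2 \<inter> (\<psi> -` N \<inter> O1)"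
    by (rule openE)
  let ?B = "ball u0 \<epsilon>"
  have B: "u \<in> O1 \<inter> S" "\<psi> u \<in> N" "\<psi> u \<in> W" if "u \<in> ?B \<inter> S" for u
  proof -
    have "u \<in> (O1 \<inter> S) \<inter> O2" "\<psi> u \<in> N"
      using that \<epsilon>(2) by auto
    then show "u \<in> O1 \<inter> S" "\<psi> u \<in> N" "\<psi> u \<in> W"
      unfolding O2(2)[symmetric] by simp_all
  qed
  have f_D: "Q (\<psi> u) \<in> D q" if u: "u \<in> ?B \<inter> S" for u
  proof (rule flat_chart_slice[OF fc S(1) convex_ball, where ?u0.0 = u0 and u = u and \<psi> = \<psi>
        and \<psi>' = "\<lambda>u. frechet_derivative \<psi> (at u)"])
    show "u0 \<in> ?B \<inter> S" using \<epsilon>(1) u0 by simp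
    show "Q (\<psi> u0) \<in> D q" using u0 f(12) subspace_0[OF subspace_D] by simp
    show "u \<in> ?B \<inter> S" by (rule u)
    show "(\<psi> has_derivative frechet_derivative \<psi> (at u)) (at u)" if "u \<in> ?B \<inter> S" for u
      using B(1)[OF that] by (intro d) auto
    show "frechet_derivative \<psi> (at u) v \<in> D (\<psi> u)" if "u \<in> ?B \<inter> S" "v \<in> S" for u v
      using S(8)[OF B(1)[OF that(1)]] that(2) by auto
    show "rank (\<psi> u) \<le> rank q" if "u \<in> ?B \<inter> S" for u
      using rank_\<psi>[OF B(1)[OF that]] rank_\<psi>[of u0] u0 by auto
  qed (rule B(2))
  let ?f = "\<lambda>u. Q (\<psi> u)"
  have f_cont: "continuous_on (?B \<inter> S) ?f"
    using B by (intro continuous_on_compose2[OF f(9)] continuous_on_subset[OF cont]) auto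
  have "openin (top_of_set (D q)) (?f ` (?B \<inter> S))"
  proof (rule invariance_of_domain[OF _ S(1) subspace_D _ f_cont])
    show "openin (top_of_set S) (?B \<inter> S)"
      by (simp add: openin_open_Int Int_commute)
    show "dim (j ` D q) \<le> dim (j ` S)"
      using rank_\<psi>[of u0] u0 by (simp add: rank_def)
    show "?f ` (?B \<inter> S) \<subseteq> D q" using f_D by auto
    show "inj_on ?f (?B \<inter> S)"
    proof (rule inj_onI)
      fix u v assume uv: "u \<in> ?B \<inter> S" "v \<in> ?B \<inter> S" "Q (\<psi> u) = Q (\<psi> v)"
      then have "\<psi> u = \<psi> v" using f(8)[OF B(2)] by metis
      then show "u = v" using inj_onD[OF inj _ B(1)[OF uv(1)] B(1)[OF uv(2)]] by simp
    qed
  qed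
  then obtain O3 where O3: "open O3" "?f ` (?B \<inter> S) = D q \<inter> O3"
    by (auto simp: openin_open)
  show thesis
  proof (rule that[of "O3 \<inter> Z"])
    show "open (O3 \<inter> Z)" using O3(1) f(1) by auto
    have "?f u0 \<in> D q \<inter> O3"
      unfolding O3(2)[symmetric] using \<epsilon>(1) u0 by (intro imageI) auto
    then show "0 \<in> O3 \<inter> Z" using u0 f(2,12) by simp
    have img: "\<exists>u\<in>?B \<inter> S. z = ?f u" if "z \<in> O3" "z \<in> D q" for z
      using that O3(2) by blast
    show "flow_box q ` (O3 \<inter> Z \<inter> D q) \<subseteq> W"
    proof clarify
      fix z assume "z \<in> O3" "z \<in> D q"
      then obtain u where "u \<in> ?B \<inter> S" "z = ?f u" using img by blast
      then show "flow_box q z \<in> W" using B f(8) by auto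
    qed
    show "openin \<tau> (flow_box q ` (V' \<inter> D q))" if V': "open V'" "V' \<subseteq> O3 \<inter> Z" for V'
    proof -
      \<comment> \<open>A small plaque is rewritten as an image under \<open>\<psi>\<close>, because
        \<open>\<psi>\<close> is a homeomorphism onto a \<tau>-open set.\<close>
      have "flow_box q ` (V' \<inter> D q) = \<psi> ` (?B \<inter> S \<inter> ?f -` V')"
      proof (intro equalityI subsetI)
        fix y assume "y \<in> flow_box q ` (V' \<inter> D q)"
        then obtain z where z: "z \<in> V'" "z \<in> D q" "y = flow_box q z" by auto
        then obtain u where u: "u \<in> ?B \<inter> S" "z = ?f u" using img V'(2) by blast
        then show "y \<in> \<psi> ` (?B \<inter> S \<inter> ?f -` V')"
          using z f(8)[OF B(2)[OF u(1)]] by (intro image_eqI[of _ _ u]) auto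
      next
        fix y assume "y \<in> \<psi> ` (?B \<inter> S \<inter> ?f -` V')"
        then obtain u where u: "u \<in> ?B \<inter> S" "?f u \<in> V'" "y = \<psi> u" by auto
        then show "y \<in> flow_box q ` (V' \<inter> D q)"
          using f(8)[OF B(2)[OF u(1)]] f_D[OF u(1)] by (intro image_eqI[of _ _ "?f u"]) auto
      qed
      moreover have "openin (top_of_set (O1 \<inter> S)) (?B \<inter> S \<inter> ?f -` V')"
      proof (rule openin_trans)
        show "openin (top_of_set (?B \<inter> S)) (?B \<inter> S \<inter> ?f -` V')"
          using f_cont V'(1) by (rule continuous_openin_preimage_gen)
        have "?B \<inter> S = (O1 \<inter> S) \<inter> ?B" using \<epsilon>(2) by auto
        then show "openin (top_of_set (O1 \<inter> S)) (?B \<inter> S)"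
          by (metis open_ball openin_open_Int)
      qed
      ultimately show ?thesis using open_\<psi> by simp
    qed
  qed auto
qed

text \<open>Each point has a neighbourhood inside its own orbit, namely a plaque. Orbits partition
  the space, so the part of the manifold in the orbit of \<open>x\<close> is clopen, and
  connectedness puts everything there. The topologies agree because small plaques are open in
  both.\<close>

lemma integral_manifold_orbit:
  assumes man: "integral_manifold D \<tau>" and conn: "connected_space \<tau>" and meet: "topspace \<tau> \<inter> orbit G act x \<noteq> {}"
  shows "openin (orbit_topology x) (topspace \<tau>)"
    and "\<tau> = subtopology (orbit_topology x) (topspace \<tau>)"
proof -
  have nbhd: "\<exists>W. openin \<tau> W \<and> q \<in> W \<and> W \<subseteq> orbit G act q" if q: "q \<in> topspace \<tau>" for q
  proof -
    obtain Z N Q where fc: "flat_chart q Z N Q" by (rule ex_flat_chart)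
    obtain V where V: "open V" "0 \<in> V"
      "\<And>V'. open V' \<Longrightarrow> V' \<subseteq> V \<Longrightarrow> openin \<tau> (flow_box q ` (V' \<inter> D q))"
      by (rule integral_manifold_flat_chart[OF man openin_topspace q fc]) blast
    have "q \<in> flow_box q ` (V \<inter> D q)"
      using V(2) subspace_0[OF subspace_D] by (intro image_eqI[of _ _ 0]) auto
    moreover have "flow_box q ` (V \<inter> D q) \<subseteq> orbit G act q"
      using flow_box_in_orbit by auto
    ultimately show ?thesis using V(3)[OF V(1) subset_refl] by blast
  qed
  have sub: "topspace \<tau> \<subseteq> orbit G act x"
  proof -
    let ?I = "topspace \<tau> \<inter> orbit G act x"
    have "openin \<tau> ?I"
    proof (subst openin_subopen, intro ballI)
      fix q assume q: "q \<in> ?I"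
      then obtain W where "openin \<tau> W" "q \<in> W" "W \<subseteq> orbit G act q" using nbhd by blast
      then show "\<exists>T. openin \<tau> T \<and> q \<in> T \<and> T \<subseteq> ?I"
        using q orbit_cong[of q x] openin_subset[of \<tau> W] by (intro exI[of _ W]) auto
    qed
    moreover have "openin \<tau> (topspace \<tau> - ?I)"
    proof (subst openin_subopen, intro ballI)
      fix q assume q: "q \<in> topspace \<tau> - ?I"
      then obtain W where W: "openin \<tau> W" "q \<in> W" "W \<subseteq> orbit G act q" using nbhd by blast
      have "y \<notin> orbit G act x" if "y \<in> W" for y
      proof
        assume "y \<in> orbit G act x"
        then have "orbit G act q = orbit G act x"
          using that W(3) orbit_cong[of y q] orbit_cong[of y x] by auto
        then show False using q orbit_self[of q] by auto
      qed
      then show "\<exists>T. openin \<tau> T \<and> q \<in> T \<and> T \<subseteq> topspace \<tau> - ?I"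
        using W openin_subset[of \<tau> W] by (intro exI[of _ W]) auto
    qed
    then have "closedin \<tau> ?I" by (simp add: closedin_def)
    ultimately have "?I = topspace \<tau>"
      using conn meet unfolding connected_space_clopen_in by blast
    then show ?thesis by blast
  qed
  \<comment> \<open>A \<tau>-open set contains a plaque around each of its points, and plaques are
    open in the orbit.\<close>
  have fine: "openin (orbit_topology x) W" if W: "openin \<tau> W" for W
  proof (subst openin_subopen, intro ballI)
    fix q assume q: "q \<in> W"
    then have qx: "q \<in> orbit G act x" using sub openin_subset[OF W] by blast
    obtain Z N Q where fc: "flat_chart q Z N Q" by (rule ex_flat_chart)
    obtain V where V: "open V" "0 \<in> V" "V \<subseteq> Z" "flow_box q ` (V \<inter> D q) \<subseteq> W"
      by (rule integral_manifold_flat_chart[OF man W q fc]) blast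
    have "q \<in> flow_box q ` (V \<inter> D q)"
      using V(2) subspace_0[OF subspace_D] by (intro image_eqI[of _ _ 0]) auto
    then show "\<exists>T. openin (orbit_topology x) T \<and> q \<in> T \<and> T \<subseteq> W"
      using flat_chart_plaque_open[OF fc qx V(1,3)] V(4) by blast
  qed
  show op: "openin (orbit_topology x) (topspace \<tau>)"
    by (rule fine[OF openin_topspace])
  \<comment> \<open>By continuity of the flow box a set open in the orbit contains a plaque around
    each of its points, and small plaques are \<tau>-open.\<close>
  have coarse: "openin \<tau> W" if W: "openin (orbit_topology x) W" "W \<subseteq> topspace \<tau>" for W
  proof (subst openin_subopen, intro ballI)
    fix q assume q: "q \<in> W"
    then have qx: "q \<in> orbit G act x" and qt: "q \<in> topspace \<tau>" using sub W(2) by auto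
    obtain Z N Q where fc: "flat_chart q Z N Q" by (rule ex_flat_chart)
    note f = flat_chartD[OF fc]
    obtain V where V: "open V" "0 \<in> V" "V \<subseteq> Z"
      "\<And>V'. open V' \<Longrightarrow> V' \<subseteq> V \<Longrightarrow> openin \<tau> (flow_box q ` (V' \<inter> D q))"
      by (rule integral_manifold_flat_chart[OF man openin_topspace qt fc]) blast
    obtain V1 where V1: "open V1"
      "\<And>u. u \<in> D q \<Longrightarrow> u \<in> flow_box_domain q \<Longrightarrow> flow_box q u \<in> W \<longleftrightarrow> u \<in> V1"
      by (rule flow_box_orbit_continuous[OF qx W(1)]) blast
    have 0: "(0::'v) \<in> D q" by (rule subspace_0[OF subspace_D])
    have "openin \<tau> (flow_box q ` (V \<inter> V1 \<inter> D q))"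
      by (rule V(4)) (use V(1) V1(1) in auto)
    moreover have "0 \<in> V1" using V1(2)[OF 0 zero_in_flow_box_domain] q by simp
    then have "q \<in> flow_box q ` (V \<inter> V1 \<inter> D q)"
      using V(2) 0 by (intro image_eqI[of _ _ 0]) auto
    moreover have "flow_box q ` (V \<inter> V1 \<inter> D q) \<subseteq> W"
      using V1(2) V(3) f(3) by auto
    ultimately show "\<exists>T. openin \<tau> T \<and> q \<in> T \<and> T \<subseteq> W" by blast
  qed
  show "\<tau> = subtopology (orbit_topology x) (topspace \<tau>)"
    unfolding topology_eq openin_open_subtopology[OF op]
    using fine coarse openin_subset by blast
qed

text \<open>A leaf and the orbit of one of its points are connected integral manifolds that meet;
  maximality of the leaf gives one inclusion, and maximality of the orbit the other.\<close>

theorem leaves_eq_orbits: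
  assumes "connected (UNIV :: 'g set)"
  shows "{L. leaf D L} = orbits G UNIV act"
proof (intro equalityI subsetI)
  fix L assume "L \<in> orbits G UNIV act"
  then obtain x where L: "L = orbit G act x" by (auto simp: orbits_def)
  have "leaf D (orbit G act x)"
    unfolding leaf_def
    using orbit_self[of x] connected_orbit_topology[OF assms] integral_manifold_orbit_topology integral_manifold_orbit
    by (intro conjI exI[of _ "orbit_topology x"]) auto
  then show "L \<in> {L. leaf D L}" by (simp add: L)
next
  fix L assume "L \<in> {L. leaf D L}"
  then obtain x \<tau> where x: "x \<in> L" and \<tau>: "topspace \<tau> = L" "connected_space \<tau>" "integral_manifold D \<tau>"
    and max: "\<And>\<tau>'. connected_space \<tau>' \<Longrightarrow> integral_manifold D \<tau>' \<Longrightarrow> topspace \<tau>' \<inter> L \<noteq> {} \<Longrightarrow>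
          openin \<tau> (topspace \<tau>')"
    unfolding leaf_def by auto
  have "openin \<tau> (topspace (orbit_topology x))"
    by (rule max[OF connected_orbit_topology[OF assms] integral_manifold_orbit_topology])
       (use x orbit_self[of x] in auto)
  then have "orbit G act x \<subseteq> L" using openin_subset \<tau>(1) by fastforce
  moreover have "openin (orbit_topology x) (topspace \<tau>)"
    by (rule integral_manifold_orbit(1)[OF \<tau>(3,2)]) (use x \<tau>(1) orbit_self[of x] in auto)
  then have "L \<subseteq> orbit G act x" using openin_subset \<tau>(1) by fastforce
  ultimately show "L \<in> orbits G UNIV act" by (auto simp: orbits_def)
qed

end

section \<open>One-parameter subgroups and the representation\<close>

text \<open>One vector \<open>w\<close>, the coordinate velocity of \<open>\<gamma>\<close> at 0,
  describes both the derivation \<open>X\<close> at the unit and the derivative along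
  \<open>\<gamma>\<close> of maps into a normed space. This ties a field known only through its
  effect on functions to the generator of the action.\<close>

lemma exp_curve_velocity:
  fixes A :: "('g::{t2_space,second_countable_topology}, 'e::euclidean_space) chart set"
  assumes G: "lie_group G A" and U: "(U, \<phi>) \<in> A" and one: "\<one>\<^bsub>G\<^esub> \<in> U" and \<gamma>: "exp_curve G A X \<gamma>"
  obtains w where
    "\<forall>f :: 'g \<Rightarrow> 'w::real_normed_vector. smooth_on (\<phi> ` U) (\<lambda>z. f (inv_into U \<phi> z)) \<longrightarrow>
       ((\<lambda>t. f (\<gamma> t)) has_vector_derivative frechet_derivative (\<lambda>z. f (inv_into U \<phi> z)) (at (\<phi> \<one>\<^bsub>G\<^esub>)) w) (at 0)"
    "\<forall>f\<in>smooth_functions A.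
       X f \<one>\<^bsub>G\<^esub> = frechet_derivative (\<lambda>z. f (inv_into U \<phi> z)) (at (\<phi> \<one>\<^bsub>G\<^esub>)) w"
proof -
  note L = lie_group_smooth[OF G]
  note u = chart_atlasD[OF L(4) U]
  interpret group G by (rule L(5))
  have sm: "smooth_map std_atlas A \<gamma>" and hom: "\<And>s t. \<gamma> (s + t) = \<gamma> s \<otimes>\<^bsub>G\<^esub> \<gamma> t"
    and deriv: "\<And>f. f \<in> smooth_functions A \<Longrightarrow> ((\<lambda>t. f (\<gamma> t)) has_real_derivative X f \<one>\<^bsub>G\<^esub>) (at 0)"
    using \<gamma> by (simp_all add: exp_curve_def)
  \<comment> \<open>\<open>\<gamma> 0\<close> is idempotent, hence the unit.\<close>
  have \<gamma>0: "\<gamma> 0 = \<one>\<^bsub>G\<^esub>"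
    using hom[of 0 0] l_cancel_one'[of "\<gamma> 0" "\<gamma> 0"] by (simp add: L(6))
  have op: "open (\<gamma> -` U)"
    using u(1) smooth_map_continuous[OF sm] by (rule open_vimage)
  have 0: "0 \<in> \<gamma> -` U" using one \<gamma>0 by simp
  have "(UNIV, id) \<in> (std_atlas :: (real, real) chart set)" by (simp add: std_atlas_def)
  from smooth_map_chart[OF sm this U] have "smooth_on (\<gamma> -` U) (\<lambda>t. \<phi> (\<gamma> t))"
    by (simp add: o_def inv_id[unfolded id_def] id_def)
  from smooth_on_has_derivative[OF this 0]
  have d: "((\<lambda>t. \<phi> (\<gamma> t)) has_derivative frechet_derivative (\<lambda>t. \<phi> (\<gamma> t)) (at 0)) (at 0)" .
  define w where "w = frechet_derivative (\<lambda>t. \<phi> (\<gamma> t)) (at 0) 1"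
  have dw: "((\<lambda>t. \<phi> (\<gamma> t)) has_derivative (\<lambda>h. h *\<^sub>R w)) (at 0)"
  proof (rule has_derivative_eq_rhs[OF d])
    interpret l: linear "frechet_derivative (\<lambda>t. \<phi> (\<gamma> t)) (at 0)"
      by (rule has_derivative_linear[OF d])
    show "frechet_derivative (\<lambda>t. \<phi> (\<gamma> t)) (at 0) = (\<lambda>h. h *\<^sub>R w)"
    proof
      fix h
      show "frechet_derivative (\<lambda>t. \<phi> (\<gamma> t)) (at 0) h = h *\<^sub>R w"
        using l.scale[of h 1] by (simp add: w_def)
    qed
  qed
  have curve: "((\<lambda>t. f (\<gamma> t)) has_vector_derivative frechet_derivative (\<lambda>z. f (inv_into U \<phi> z)) (at (\<phi> \<one>\<^bsub>G\<^esub>)) w) (at 0)"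
    if f: "smooth_on (\<phi> ` U) (\<lambda>z. f (inv_into U \<phi> z))" for f :: "'g \<Rightarrow> 'x::real_normed_vector"
  proof -
    let ?F = "\<lambda>z. f (inv_into U \<phi> z)"
    have dF: "(?F has_derivative frechet_derivative ?F (at (\<phi> (\<gamma> 0)))) (at (\<phi> (\<gamma> 0)))"
      using one by (intro smooth_on_has_derivative[OF f]) (simp add: \<gamma>0)
    interpret l: linear "frechet_derivative ?F (at (\<phi> (\<gamma> 0)))"
      by (rule has_derivative_linear[OF dF])
    have "((\<lambda>t. ?F (\<phi> (\<gamma> t))) has_derivative (\<lambda>h. frechet_derivative ?F (at (\<phi> (\<gamma> 0))) (h *\<^sub>R w))) (at 0)"
      by (rule has_derivative_compose[OF dw dF])
    then have "((\<lambda>t. f (\<gamma> t)) has_derivative (\<lambda>h. frechet_derivative ?F (at (\<phi> (\<gamma> 0))) (h *\<^sub>R w))) (at 0)"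
      by (rule has_derivative_transform_within_open[OF _ op 0]) (use u(3) in simp)
    then show ?thesis
      by (simp add: has_vector_derivative_def l.scale[unfolded \<gamma>0] \<gamma>0)
  qed
  show thesis
  proof (rule that, intro allI impI, rule curve, assumption, intro ballI)
    fix f assume f: "f \<in> smooth_functions A"
    have "((\<lambda>t. f (\<gamma> t)) has_vector_derivative frechet_derivative (\<lambda>z. f (inv_into U \<phi> z)) (at (\<phi> \<one>\<^bsub>G\<^esub>)) w) (at 0)"
      using f U unfolding smooth_functions_iff[OF L(4)] by (intro curve) auto
    from DERIV_unique[OF deriv[OF f] this[folded has_real_derivative_iff_has_vector_derivative]]
    show "X f \<one>\<^bsub>G\<^esub> = frechet_derivative (\<lambda>z. f (inv_into U \<phi> z)) (at (\<phi> \<one>\<^bsub>G\<^esub>)) w" .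
  qed
qed

text \<open>Left invariance reads \<open>X f g\<close> as the value at the unit of \<open>X\<close>
  on a translate of \<open>f\<close>; off the smooth functions both fields take the same default
  value, being extensional.\<close>

lemma lie_algebra_eq_at_one:
  assumes X: "X \<in> lie_algebra G A" and Y: "Y \<in> lie_algebra G A" and G: "lie_group G A"
    and eq: "\<And>f. f \<in> smooth_functions A \<Longrightarrow> X f \<one>\<^bsub>G\<^esub> = Y f \<one>\<^bsub>G\<^esub>"
  shows "X = Y"
proof
  fix f
  note L = lie_group_smooth[OF G]
  interpret group G by (rule L(5))
  show "X f = Y f"
  proof (cases "f \<in> smooth_functions A")
    case True
    have "X f g = Y f g" for g
    proof -
      have "(\<lambda>p. f (g \<otimes>\<^bsub>G\<^esub> p)) \<in> smooth_functions A"
        by (rule smooth_functions_compose[OF L(4) L(4) L(1) True])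
      from eq[OF this] show ?thesis
        using X Y True by (simp add: lie_algebra_def L(6))
    qed
    then show ?thesis by auto
  next
    case False
    then show ?thesis
      using X Y by (auto simp: lie_algebra_def vector_fields_def PiE_def extensional_def)
  qed
qed

text \<open>The norm of \<open>'v\<close> is arbitrary, so boundedness needs compactness in the
  Euclidean space: on the unit sphere of the range of \<open>j\<close> the norm of
  \<open>r e\<close> has a positive lower bound \<open>m\<close>, and scaling gives
  \<open>m * norm (j x) \<le> norm x\<close>.\<close>

lemma bounded_linear_of_left_inverse:
  fixes j :: "'v::real_normed_vector \<Rightarrow> 'e::euclidean_space"
  assumes "linear j" "linear r" and rj: "\<And>x. r (j x) = x"
  shows "bounded_linear j"
proof -
  interpret j: linear j by fact
  interpret r: linear r by fact
  let ?S = "sphere 0 1 \<inter> range j"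
  have "subspace (range j)"
    using linear_subspace_image[OF assms(1) subspace_UNIV] .
  then have S: "compact ?S"
    by (intro compact_Int_closed closed_subspace) auto
  have cr: "continuous_on ?S (\<lambda>e. norm (r e))"
    using assms(2) linear_conv_bounded_linear[of r] by (intro continuous_on_norm linear_continuous_on) simp
  obtain m where m: "m > 0" "\<And>e. e \<in> ?S \<Longrightarrow> m \<le> norm (r e)"
  proof (cases "?S = {}")
    case True
    \<comment> \<open>Without unit vectors in its range \<open>j\<close> is 0, and any positive
      bound will do.\<close>
    show thesis by (rule that[of 1]) (use True in auto)
  next
    case False
    obtain e0 where e0: "e0 \<in> ?S" "\<forall>e\<in>?S. norm (r e0) \<le> norm (r e)"
      using continuous_attains_inf[OF S False cr] by (rule bexE)
    have "r e0 \<noteq> 0"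
    proof
      assume "r e0 = 0"
      moreover obtain x where "e0 = j x" using e0(1) by auto
      ultimately have "e0 = 0" using rj[of x] by (simp add: j.zero)
      then show False using e0(1) by simp
    qed
    then show thesis using e0(2) by (intro that[of "norm (r e0)"]) auto
  qed
  show ?thesis
  proof (rule bounded_linear_intro[where K = "1 / m"])
    fix x
    show "norm (j x) \<le> norm x * (1 / m)"
    proof (cases "j x = 0")
      case True
      then show ?thesis using m(1) by simp
    next
      case False
      have "(1 / norm (j x)) *\<^sub>R j x = j ((1 / norm (j x)) *\<^sub>R x)" by (simp add: j.scale)
      then have "(1 / norm (j x)) *\<^sub>R j x \<in> range j" by (rule range_eqI)
      moreover have "norm ((1 / norm (j x)) *\<^sub>R j x) = 1" using False by simp
      ultimately have "(1 / norm (j x)) *\<^sub>R j x \<in> ?S" by (simp only: mem_sphere_0 Int_iff simp_thms)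
      from m(2)[OF this] have "m \<le> norm x / norm (j x)"
        by (simp add: r.scale rj)
      then show ?thesis using m(1) False by (simp add: field_simps)
    qed
  qed (simp_all add: j.add j.scale)
qed

lemma linear_imp_affine_map: "linear f \<Longrightarrow> affine_map f"
  unfolding affine_map_def by (intro exI[of _ f] exI[of _ 0]) simp

lemma affine_map_add_const: "linear f \<Longrightarrow> affine_map (\<lambda>x. f x + c)"
  unfolding affine_map_def by auto

text \<open>\<open>lie_algebra_iso\<close> speaks of binary combinations; the embedding needs finite
  sums over a basis.\<close>

lemma lie_algebra_iso_sum:
  fixes \<Lambda> :: "'v::real_normed_vector bivector_field"
  assumes iso: "lie_algebra_iso \<Lambda> E G A \<iota>" and f: "f \<in> smooth_functions A"
    and I: "finite I" and lin: "\<And>i. i \<in> I \<Longrightarrow> linear (a i :: 'v \<Rightarrow> real)"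
  shows "\<iota> (\<lambda>x. \<Sum>i\<in>I. c i * a i x) f p = (\<Sum>i\<in>I. c i * \<iota> (a i) f p)"
proof -
  have lin_comb: "\<iota> (\<lambda>x. s * b x + t * b' x) = vf_lincomb A s (\<iota> b) t (\<iota> b')"
    if "affine_map b" "affine_map b'" for s t b b'
    using iso that unfolding lie_algebra_iso_def by blast
  show ?thesis
    using I lin
  proof (induction I rule: finite_induct)
    case empty
    have z: "affine_map (\<lambda>x::'v. 0::real)"
      by (intro linear_imp_affine_map linearI) simp_all
    \<comment> \<open>The zero function as a combination with zero coefficients: this is how
      \<open>\<iota>\<close> is seen to send it to the zero field.\<close>
    have "\<iota> (\<lambda>x. 0 * 0 + 0 * 0) = vf_lincomb A 0 (\<iota> (\<lambda>x. 0)) 0 (\<iota> (\<lambda>x. 0))"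
      by (rule lin_comb[OF z z])
    then show ?case using f by (simp add: vf_lincomb_def)
  next
    case (insert i I)
    have lin_sum: "linear (\<lambda>x. \<Sum>i\<in>I. c i * a i x)"
      using insert.prems
      by (intro linear_compose_sum) (auto simp flip: real_scaleR_def intro: linear_compose_scale_right)
    have "\<iota> (\<lambda>x. c i * a i x + 1 * (\<Sum>i\<in>I. c i * a i x)) =
        vf_lincomb A (c i) (\<iota> (a i)) 1 (\<iota> (\<lambda>x. \<Sum>i\<in>I. c i * a i x))"
      by (rule lin_comb[OF linear_imp_affine_map linear_imp_affine_map[OF lin_sum]])
         (use insert.prems in simp)
    then show ?case
      using insert f by (simp add: vf_lincomb_def)
  qed
qed

text \<open>What remains is to build the embedding \<open>j\<close> and to identify
  \<open>S.D\<close> with the characteristic distribution. Both rest on the passage from an affine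
  function \<open>a\<close> to the coordinates \<open>w a\<close> of \<open>\<iota> a\<close> at the
  unit.\<close>

theorem theorem6p1:
  fixes \<Lambda> :: "'v::real_normed_vector bivector_field" and E :: "'v \<Rightarrow> 'v"
    and G :: "'g::{t2_space,second_countable_topology} monoid"
    and A :: "('g, 'e::euclidean_space) chart set"
    and \<iota> :: "('v \<Rightarrow> real) \<Rightarrow> ('g \<Rightarrow> real) \<Rightarrow> 'g \<Rightarrow> real"
    and Coad :: "'g \<Rightarrow> 'v \<Rightarrow> 'v"
  assumes finite_dim: "\<exists>B::'v set. finite B \<and> span B = UNIV"
    and jacobi: "jacobi_structure \<Lambda> E"
    and strongly_affine: "strongly_affine \<Lambda> E"
    and lie_group: "lie_group G A"
    and connected: "connected (UNIV :: 'g set)"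
    and simply_connected: "simply_connected (UNIV :: 'g set)"
    and lie_algebra: "lie_algebra_iso \<Lambda> E G A \<iota>"
    and representation: "affine_representation G A Coad"
    and infinitesimal: "\<And>a. affine_map a \<Longrightarrow>
          infinitesimal_generator G A Coad (\<iota> a) (\<lambda>x. - hamiltonian \<Lambda> E a x)"
  shows "{L. leaf (characteristic_distribution \<Lambda> E) L} = orbits G UNIV Coad"
proof -
  note L = lie_group_smooth[OF lie_group]
  interpret grp: group G by (rule L(5))
  obtain U \<phi> where U: "(U, \<phi>) \<in> A" "\<one>\<^bsub>G\<^esub> \<in> U"
    by (rule chart_atlas_cover[OF L(4)])
  note u = chart_atlasD[OF L(4) U(1)]
  let ?e = "\<phi> \<one>\<^bsub>G\<^esub>"
  let ?d = "\<lambda>f. frechet_derivative (\<lambda>z. f (inv_into U \<phi> z)) (at ?e)"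
  let ?T = "\<lambda>x. frechet_derivative (\<lambda>z. Coad (inv_into U \<phi> z) x) (at ?e)"
  have Coad: "group_action G UNIV Coad"
    "smooth_map (prod_atlas A std_atlas) std_atlas (\<lambda>(g, x). Coad g x)"
    using representation by (simp_all add: affine_representation_def)
  have orbit_smooth: "smooth_on (\<phi> ` U) (\<lambda>z. Coad (inv_into U \<phi> z) x)" for x
  proof -
    have "smooth_map A std_atlas (\<lambda>g. Coad g x)"
      using smooth_map_slice_left[OF L(4) chart_atlas_std chart_atlas_std Coad(2), of x] by simp
    moreover have "(UNIV, id) \<in> (std_atlas :: ('v, 'v) chart set)" by (simp add: std_atlas_def)
    ultimately show ?thesis
      using smooth_map_chart[OF _ U(1)] by (fastforce simp: o_def)
  qed
  \<comment> \<open>\<open>v\<close> represents \<open>\<iota> a\<close> at the unit in two ways, as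
    a derivation and through the action; \<open>exp_curve_velocity\<close> provides one vector for
    both.\<close>
  define P where "P a v \<longleftrightarrow> (\<forall>f\<in>smooth_functions A. \<iota> a f \<one>\<^bsub>G\<^esub> = ?d f v) \<and> (\<forall>x. ?T x v = - hamiltonian \<Lambda> E a x)" for a v
  have ex_P: "\<exists>v. P a v" if a: "affine_map a" for a
  proof -
    obtain \<gamma> where \<gamma>: "exp_curve G A (\<iota> a) \<gamma>"
      "\<And>x. ((\<lambda>t. Coad (\<gamma> t) x) has_vector_derivative - hamiltonian \<Lambda> E a x) (at 0)"
      using infinitesimal[OF a] by (auto simp: infinitesimal_generator_def)
    obtain w where w:
      "\<forall>f :: 'g \<Rightarrow> 'v. smooth_on (\<phi> ` U) (\<lambda>z. f (inv_into U \<phi> z)) \<longrightarrow>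
         ((\<lambda>t. f (\<gamma> t)) has_vector_derivative frechet_derivative (\<lambda>z. f (inv_into U \<phi> z)) (at ?e) w) (at 0)"
      "\<forall>f\<in>smooth_functions A. \<iota> a f \<one>\<^bsub>G\<^esub> = ?d f w"
      by (rule exp_curve_velocity[OF lie_group U \<gamma>(1), where 'w = 'v])
    have "?T x w = - hamiltonian \<Lambda> E a x" for x
      by (rule vector_derivative_unique_at[OF w(1)[rule_format, OF orbit_smooth] \<gamma>(2)])
    then have "P a w" using w(2) by (simp add: P_def)
    then show ?thesis by (rule exI)
  qed
  define w where "w a = (SOME v. P a v)" for a
  have P_w: "P a (w a)" if "affine_map a" for a
    unfolding w_def by (rule someI_ex[OF ex_P[OF that]])
  have w: "\<And>a f. affine_map a \<Longrightarrow> f \<in> smooth_functions A \<Longrightarrow> \<iota> a f \<one>\<^bsub>G\<^esub> = ?d f (w a)"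
    "\<And>a x. affine_map a \<Longrightarrow> ?T x (w a) = - hamiltonian \<Lambda> E a x"
    using P_w by (simp_all add: P_def)
  have bij: "bij_betw \<iota> {a. affine_map a} (lie_algebra G A)"
    using lie_algebra by (simp add: lie_algebra_iso_def)
  \<comment> \<open>Every \<open>v\<close> is the value at the unit of a left-invariant field, which
    is some \<open>\<iota> a\<close>. Then \<open>v\<close> and \<open>w a\<close> differentiate
    smooth functions alike, and a function separating in the direction \<open>w a - v\<close> shows
    them equal.\<close>
  have w_surj: "\<exists>a. affine_map a \<and> w a = v" for v
  proof -
    have "left_invariant_field G A U \<phi> v \<in> lie_algebra G A"
      by (rule left_invariant_field_in_lie_algebra[OF lie_group U])
    then have "left_invariant_field G A U \<phi> v \<in> \<iota> ` {a. affine_map a}"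
      using bij_betw_imp_surj_on[OF bij] by simp
    then obtain a where a: "affine_map a" "\<iota> a = left_invariant_field G A U \<phi> v"
      by auto
    have d: "?d f (w a) = ?d f v" if "f \<in> smooth_functions A" for f
      using w(1)[OF a(1) that] that by (simp add: a(2) left_invariant_field_def L(6))
    obtain f c where f: "f \<in> smooth_functions A" "c > 0"
      "((\<lambda>z. f (inv_into U \<phi> z)) has_derivative (\<lambda>x. c * (x \<bullet> (w a - v)))) (at ?e)"
      by (rule separating_function[OF L(3) U])
    have "c * (w a \<bullet> (w a - v)) = c * (v \<bullet> (w a - v))"
      using d[OF f(1)] by (simp add: frechet_derivative_at[OF f(3), symmetric])
    then have "(w a - v) \<bullet> (w a - v) = 0"
      using f(2) by (simp add: inner_diff_left)
    then show ?thesis using a(1) by auto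
  qed
  obtain B0 :: "'v set" where B0: "finite B0" "span B0 = UNIV"
    using finite_dim by (elim exE conjE) (rule that)
  obtain B where B: "B \<subseteq> B0" "independent B" "B0 \<subseteq> span B"
    by (rule maximal_independent_subset)
  have spB: "x \<in> span B" for x
    using span_mono[OF B(3)] B0(2) by (simp add: span_span) blast
  have finB: "finite B" by (rule finite_subset[OF B(1) B0(1)])
  let ?b = "\<lambda>b x. real_vector.representation B x b"
  have lin_b: "linear (?b b)" for b
    by (rule linearI) (simp_all add: real_vector.representation_add[OF B(2) spB spB]
        real_vector.representation_scale[OF B(2) spB])
  \<comment> \<open>\<open>x\<close> goes to the linear function \<open>?a\<close> below, the inner
    product with \<open>x\<close> that makes \<open>B\<close> orthonormal, and then to the
    coordinates of its field at the unit, written out by linearity. If \<open>j x = 0\<close>, the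
    field and hence the function vanish; but its value at \<open>x\<close> is the sum of the squares
    of the coordinates of \<open>x\<close>.\<close>
  define j where "j x = (\<Sum>b\<in>B. ?b b x *\<^sub>R w (?b b))" for x
  have lin_j: "linear j"
    unfolding j_def[abs_def]
    by (rule linearI) (simp_all add: linear_add[OF lin_b] linear_cmul[OF lin_b] scaleR_left_distrib
        sum.distrib scaleR_sum_right)
  have "x = 0" if "j x = 0" for x
  proof -
    let ?a = "\<lambda>y. \<Sum>b\<in>B. ?b b x * ?b b y"
    have a: "affine_map ?a"
      by (intro linear_imp_affine_map linearI)
         (simp_all add: linear_add[OF lin_b] linear_cmul[OF lin_b] distrib_left sum.distrib sum_distrib_left mult.left_commute)
    have z: "affine_map (\<lambda>y::'v. 0::real)"
      by (intro linear_imp_affine_map linearI) simp_all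
    have "\<iota> ?a f \<one>\<^bsub>G\<^esub> = \<iota> (\<lambda>y. 0) f \<one>\<^bsub>G\<^esub>" if f: "f \<in> smooth_functions A" for f
    proof -
      have "(\<lambda>z. f (inv_into U \<phi> z)) differentiable (at ?e)"
        using f U unfolding smooth_functions_iff[OF L(4)]
        by (auto intro!: smooth_on_differentiable)
      then interpret l: linear "?d f" by (rule linear_frechet_derivative)
      have "\<iota> ?a f \<one>\<^bsub>G\<^esub> = (\<Sum>b\<in>B. ?b b x * \<iota> (?b b) f \<one>\<^bsub>G\<^esub>)"
        by (rule lie_algebra_iso_sum[OF lie_algebra f finB lin_b])
      also have "\<dots> = ?d f (j x)"
        by (simp add: j_def l.sum l.scale w(1)[OF linear_imp_affine_map[OF lin_b] f])
      \<comment> \<open>The sum lemma over the empty set evaluates the field of the zero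
        function.\<close>
      also have "\<dots> = \<iota> (\<lambda>y. 0) f \<one>\<^bsub>G\<^esub>"
        using lie_algebra_iso_sum[OF lie_algebra f finite.emptyI, where p = "\<one>\<^bsub>G\<^esub>"]
        by (simp add: \<open>j x = 0\<close> l.zero)
      finally show ?thesis .
    qed
    then have "\<iota> ?a = \<iota> (\<lambda>y. 0)"
      using bij a z by (intro lie_algebra_eq_at_one[OF _ _ lie_group]) (auto simp: bij_betw_def)
    then have "?a = (\<lambda>y. 0)"
      using bij_betw_imp_inj_on[OF bij] a z by (auto dest: inj_onD)
    then have "(\<Sum>b\<in>B. ?b b x * ?b b x) = 0" by (rule fun_cong)
    then have "?b b x = 0" if "b \<in> B" for b
      using that finB by (simp add: sum_nonneg_eq_0_iff)
    moreover have "(\<Sum>b\<in>B. ?b b x *\<^sub>R b) = x"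
      by (rule real_vector.sum_representation_eq[OF B(2) spB finB subset_refl])
    ultimately show "x = 0" by simp
  qed
  then have inj_j: "inj j"
    using linear_injective_0[OF lin_j] by blast
  obtain r where r: "linear r" "r \<circ> j = id"
    using linear_injective_left_inverse[OF lin_j inj_j] by blast
  then have rj: "r (j x) = x" for x by (simp add: fun_eq_iff)
  have blj: "bounded_linear j"
    by (rule bounded_linear_of_left_inverse[OF lin_j r(1) rj])
  have blr: "bounded_linear r"
    using r(1) by (simp add: linear_conv_bounded_linear)
  interpret S: smooth_action j r G A Coad U \<phi>
    by (intro smooth_action.intro embedded_space.intro smooth_action_axioms.intro)
       (fact blj blr rj lie_group Coad U)+
  have "characteristic_distribution \<Lambda> E = S.D"
  proof (intro ext Set.set_eqI iffI)
    fix x y assume "y \<in> characteristic_distribution \<Lambda> E x"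
    then obtain \<alpha> s where y: "y = sharp \<Lambda> x \<alpha> + s *\<^sub>R E x"
      by (auto simp: characteristic_distribution_def)
    \<comment> \<open>The affine function with differential \<open>\<alpha>\<close> and value
      \<open>s\<close> at \<open>x\<close>; its hamiltonian field at \<open>x\<close> is the given
      vector.\<close>
    define a where "a z = blinfun_apply \<alpha> z + (s - blinfun_apply \<alpha> x)" for z
    have a: "affine_map a"
      unfolding a_def[abs_def]
      by (rule affine_map_add_const[OF bounded_linear.linear[OF blinfun.bounded_linear_right]])
    have "(a has_derivative blinfun_apply \<alpha>) (at x)"
      unfolding a_def[abs_def]
      using has_derivative_add[OF bounded_linear_imp_has_derivative[OF blinfun.bounded_linear_right] has_derivative_const]
      by simp
    then have "diff a x = \<alpha>"
      by (simp add: diff_def frechet_derivative_at[symmetric] blinfun_apply_inverse)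
    then have "y = hamiltonian \<Lambda> E a x"
      by (simp add: y hamiltonian_def a_def)
    \<comment> \<open>The generator is minus the hamiltonian field; linearity of
      \<open>S.T x\<close> absorbs the sign.\<close>
    then have "y = S.T x (- w a)"
      using w(2)[OF a, of x] linear_neg[OF S.linear_T[of x]] by (simp add: S.T_def)
    then show "y \<in> S.D x" by (simp add: S.D_def)
  next
    fix x y assume "y \<in> S.D x"
    then obtain v where v: "y = S.T x v" by (auto simp: S.D_def)
    obtain a where a: "affine_map a" "w a = - v" using w_surj[of "- v"] by (elim exE conjE) (rule that)
    have "y = hamiltonian \<Lambda> E a x"
      using w(2)[OF a(1), of x] linear_neg[OF S.linear_T[of x]] by (simp add: S.T_def a(2) v)
    then show "y \<in> characteristic_distribution \<Lambda> E x"
      unfolding hamiltonian_def characteristic_distribution_def by blast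
  qed
  then show ?thesis
    using S.leaves_eq_orbits[OF connected] by simp
qed

end
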